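(* The reachability problem $\mathrm{REACH}(\mathcal C_{\mathbf 1})$ is decidable: given an affine $\mathbb Z$-VASS $\mathcal V=(d,Q,T)$ all of whose transition matrices are of the form $J_d^n$ with $n\in\mathbb N$ (where $J_d^0=I$), and configurations $p(\mathbf u),q(\mathbf v)$, it is decidable whether $p(\mathbf u)\xrightarrow{*}q(\mathbf v)$.
   Context: $J_d\in\mathbb N^{d\times d}$ denotes the matrix all of whose entries equal $1$, and $\mathcal C_{\mathbf 1}=\bigcup_{d\ge1}\{J_d^n:n\in\mathbb N\}$ (the monoids generated by $J_d$). An affine $\mathbb Z$-VASS is $\mathcal V=(d,Q,T)$ with $Q$ finite and $T\subseteq Q\times\mathbb Z^{d\times d}\times\mathbb Z^d\times Q$ finite; configurations are $q(\mathbf v)\in Q\times\mathbb Z^d$; $p(\mathbf u)\xrightarrow{t}q(\mathbf v)$ iff $t=(p,A,\mathbf b,q)\in T$ and $\mathbf v=A\mathbf u+\mathbf b$; $\xrightarrow{*}$ is the reflexive-transitive closure of the union of these relations. *)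

theory Defs
  imports Jordan_Normal_Form.Matrix "HOL-Library.Nat_Bijection"
begin

section \<open>Partial recursive functions and decidable problems\<close>

text \<open>Kleene's partial recursive functions, as syntactic descriptions with an evaluation
  relation: \<open>rec_eval f xs y\<close> says that \<open>f\<close> halts on the arguments \<open>xs\<close> with value \<open>y\<close>.\<close>

datatype recf =
    Zero
  | Succ
  | Proj nat
  | Comp recf "recf list"
  | PrimRec recf recf
  | Mu recf

inductive rec_eval :: "recf \<Rightarrow> nat list \<Rightarrow> nat \<Rightarrow> bool" where
  Zero: "rec_eval Zero xs 0"
| Succ: "rec_eval Succ [x] (Suc x)"
| Proj: "i < length xs \<Longrightarrow> rec_eval (Proj i) xs (xs ! i)"
| Comp: "list_all2 (\<lambda>g y. rec_eval g xs y) gs ys \<Longrightarrow> rec_eval f ys z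
    \<Longrightarrow> rec_eval (Comp f gs) xs z"
| PrimRec_0: "rec_eval f xs y \<Longrightarrow> rec_eval (PrimRec f g) (0 # xs) y"
| PrimRec_Suc: "rec_eval (PrimRec f g) (n # xs) y \<Longrightarrow> rec_eval g (n # y # xs) z
    \<Longrightarrow> rec_eval (PrimRec f g) (Suc n # xs) z"
| Mu: "rec_eval f (n # xs) 0 \<Longrightarrow> (\<forall>m<n. \<exists>y. rec_eval f (m # xs) (Suc y))
    \<Longrightarrow> rec_eval (Mu f) xs n"

inductive_cases rec_eval_ZeroE: "rec_eval Zero xs y"
inductive_cases rec_eval_SuccE: "rec_eval Succ xs y"
inductive_cases rec_eval_ProjE: "rec_eval (Proj i) xs y"
inductive_cases rec_eval_CompE: "rec_eval (Comp f gs) xs y"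
inductive_cases rec_eval_PrimRec_0E: "rec_eval (PrimRec f g) (0 # xs) y"
inductive_cases rec_eval_PrimRec_SucE: "rec_eval (PrimRec f g) (Suc n # xs) y"
inductive_cases rec_eval_MuE: "rec_eval (Mu f) xs y"

lemma rec_eval_deterministic: "rec_eval f xs y \<Longrightarrow> rec_eval f xs y' \<Longrightarrow> y = y'"
proof (induction f xs y arbitrary: y' rule: rec_eval.induct)
  case (Comp xs gs ys f z)
  from Comp.prems obtain ys' where ys': "list_all2 (\<lambda>g y. rec_eval g xs y) gs ys'"
    and z: "rec_eval f ys' y'"
    by (rule rec_eval_CompE)
  have "ys = ys'"
    using Comp.IH(1) ys' by (auto simp: list_all2_conv_all_nth intro!: nth_equalityI)
  with z Comp.IH(2) show ?case by blast
next
  case (PrimRec_Suc f g n xs y z)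
  from PrimRec_Suc.prems obtain y2 where "rec_eval (PrimRec f g) (n # xs) y2"
    and "rec_eval g (n # y2 # xs) y'"
    by (rule rec_eval_PrimRec_SucE)
  with PrimRec_Suc.IH show ?case by blast
next
  case (Mu f n xs)
  from Mu.prems have y': "rec_eval f (y' # xs) 0"
    and below: "\<forall>m<y'. \<exists>y. rec_eval f (m # xs) (Suc y)"
    by (blast elim: rec_eval_MuE)+
  show ?case
  proof (rule linorder_cases[of n y'])
    assume "n < y'"
    with below Mu.IH(1) show ?thesis by blast
  next
    assume "y' < n"
    with y' Mu.IH(2) show ?thesis by fastforce
  qed
qed (blast elim: rec_eval_ZeroE rec_eval_SuccE rec_eval_ProjE rec_eval_PrimRec_0E)+

text \<open>A problem is given by a set \<open>I\<close> of instances, an encoding of instances by natural numbers,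
  and the property \<open>P\<close> to be decided. One algorithm has to halt with the correct answer on every
  instance; as \<open>I\<close> is the set of admissible inputs, nothing is required on other numbers.\<close>

definition decidable_problem :: "('a \<Rightarrow> nat) \<Rightarrow> 'a set \<Rightarrow> ('a \<Rightarrow> bool) \<Rightarrow> bool" where
  "decidable_problem enc I P \<longleftrightarrow>
     (\<exists>f. \<forall>x\<in>I. rec_eval f [enc x] (if P x then 1 else 0))"


section \<open>Affine integer vector addition systems with states\<close>

type_synonym 's transition = "'s \<times> int mat \<times> int vec \<times> 's"

type_synonym 's config = "'s \<times> int vec"

record 's vass =
  vdim :: nat
  states :: "'s set"
  transitions :: "'s transition set"

definition affine_zvass :: "'s vass \<Rightarrow> bool" where
  "affine_zvass V \<longleftrightarrow>
     vdim V \<ge> 1 \<and> finite (states V) \<and> finite (transitions V) \<and>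
     transitions V \<subseteq>
       states V \<times> carrier_mat (vdim V) (vdim V) \<times> carrier_vec (vdim V) \<times> states V"

definition configs :: "'s vass \<Rightarrow> 's config set" where
  "configs V = states V \<times> carrier_vec (vdim V)"

definition fires :: "'s transition \<Rightarrow> 's config \<Rightarrow> 's config \<Rightarrow> bool" where
  "fires t c c' \<longleftrightarrow>
     (\<exists>p A b q u v. t = (p, A, b, q) \<and> c = (p, u) \<and> c' = (q, v) \<and> v = A *\<^sub>v u + b)"

definition step :: "'s vass \<Rightarrow> 's config \<Rightarrow> 's config \<Rightarrow> bool" where
  "step V c c' \<longleftrightarrow> c \<in> configs V \<and> c' \<in> configs V \<and> (\<exists>t\<in>transitions V. fires t c c')"

definition reachable :: "'s vass \<Rightarrow> 's config \<Rightarrow> 's config \<Rightarrow> bool" where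
  "reachable V = (step V)\<^sup>*\<^sup>*"


section \<open>The reachability problem for a class of matrices\<close>

definition J :: "nat \<Rightarrow> int mat" where
  "J d = mat d d (\<lambda>_. 1)"

definition C_ones :: "int mat set" where
  "C_ones = (\<Union>d\<in>{1..}. {J d ^\<^sub>m n | n. True})"

text \<open>Inputs to an algorithm are finite objects, so the states of an instance are named by
  natural numbers.\<close>

type_synonym instance_data = "nat vass \<times> nat config \<times> nat config"

definition reach_instances :: "int mat set \<Rightarrow> instance_data set" where
  "reach_instances C =
     {(V, c, c'). affine_zvass V \<and> (\<forall>(p, A, b, q)\<in>transitions V. A \<in> C) \<and>
        c \<in> configs V \<and> c' \<in> configs V}"

definition encode_vec :: "int vec \<Rightarrow> nat" where
  "encode_vec v = list_encode (map int_encode (list_of_vec v))"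

definition encode_mat :: "int mat \<Rightarrow> nat" where
  "encode_mat A = list_encode (map (\<lambda>r. list_encode (map int_encode r)) (mat_to_list A))"

definition encode_transition :: "nat transition \<Rightarrow> nat" where
  "encode_transition = (\<lambda>(p, A, b, q).
     list_encode [p, encode_mat A, encode_vec b, q])"

definition encode_config :: "nat config \<Rightarrow> nat" where
  "encode_config = (\<lambda>(q, v). prod_encode (q, encode_vec v))"

definition encode_vass :: "nat vass \<Rightarrow> nat" where
  "encode_vass V = list_encode
     [vdim V, set_encode (states V), set_encode (encode_transition ` transitions V)]"

definition encode_instance :: "instance_data \<Rightarrow> nat" where
  "encode_instance = (\<lambda>(V, c, c').
     list_encode [encode_vass V, encode_config c, encode_config c'])"

end

theory Submission
  imports Defs "HOL-Library.Disjoint_Sets" "HOL-Library.Multiset" "HOL-Library.FuncSet"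
begin

text \<open>
  Reachability is decided by exhibiting a computable bound on the length of a shortest run.
  A step with the matrix \<open>J\<^sup>n\<close>, \<open>n \<ge> 1\<close>, forgets everything about the current vector except the sum
  of its entries, and it multiplies this sum by \<open>d\<^sup>n \<ge> 2\<close> (for \<open>d = 1\<close> all matrices are the identity).
  Between two such steps the system is an ordinary integer VASS, whose walks consist of a short
  skeleton and many short cycles; as zero-sum families of bounded vectors split into zero-sum blocks of
  bounded size, such walks can be shortened, and the set of sums they can add is periodic with a
  common period beyond a common threshold. What remains is a one-dimensional system
  \<open>x \<mapsto> m (x + e) + a\<close> with \<open>m \<ge> 2\<close> and periodic sets of admissible \<open>e\<close>. Lowering a large value by a
  multiple of the period can be compensated by the later steps that bring the value down again, so
  in a shortest run no two large values at the same node are congruent modulo the period. This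
  bounds all values and hence the length of the run.
\<close>

section \<open>Computable functions\<close>

text \<open>An effect between two multiplications has the form \<open>w + x\<close> with a fixed
  vector \<open>w\<close> and one free integer \<open>x\<close> added in every coordinate. Before a
  further multiplication only the entry sum counts, which is repeated in all coordinates. After the
  last one the whole target counts, but the multiplied vector is constant before its offset is
  added, so its common entry is again the only unknown. Thus one splitting argument serves both
  kinds of segment and gives them the same period and threshold.

  Compensation has a direction: a run can be cut only from a large value to a later one that exceeds
  it by a multiple of the period. Hence successive records are compared, and their growth must be
  controlled; this is where minimal step sizes enter, since a huge upward step could otherwise leave
  too few records. The end value is normalised to 0, so negation is a symmetry and turns the upper
  bound into a lower one.

  With a computable bound the decision is a search over finitely many codes, for which primitive
  recursion suffices.\<close>

text \<open>The function \<open>F\<close> takes an environment assigning values to the variables \<open>0, 1, \<dots>\<close> and may depend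
  only on the first \<open>k\<close> of them. Binders shift the environment by one or two places, which makes
  the closure rules below applicable by higher-order unification.\<close>

definition computable :: "nat \<Rightarrow> ((nat \<Rightarrow> nat) \<Rightarrow> nat) \<Rightarrow> bool" where
  "computable k F \<longleftrightarrow> (\<exists>r. \<forall>e. rec_eval r (map e [0..<k]) (F e))"

definition decidable_in :: "nat \<Rightarrow> ((nat \<Rightarrow> nat) \<Rightarrow> bool) \<Rightarrow> bool" where
  "decidable_in k P \<longleftrightarrow> computable k (\<lambda>e. of_bool (P e))"

named_theorems computable_intros

lemma computable_var [computable_intros]: "i < k \<Longrightarrow> computable k (\<lambda>e. e i)"
  unfolding computable_def
  by (metis (no_types, lifting) Proj diff_zero length_map length_upt nth_map_upt plus_nat.add_0)

text \<open>Besides composition this covers renaming: taking variables for \<open>G\<close> inserts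
  or skips places in the environment.\<close>

lemma computable_subst:
  assumes "computable m F" and "\<And>i. i < m \<Longrightarrow> computable k (G i)"
  shows "computable k (\<lambda>e. F (\<lambda>i. G i e))"
proof -
  obtain r where r: "\<And>e. rec_eval r (map e [0..<m]) (F e)"
    using assms(1) unfolding computable_def by blast
  have "\<forall>i. \<exists>s. i < m \<longrightarrow> (\<forall>e. rec_eval s (map e [0..<k]) (G i e))"
    using assms(2) unfolding computable_def by blast
  then obtain s where s: "\<And>i e. i < m \<Longrightarrow> rec_eval (s i) (map e [0..<k]) (G i e)"
    by metis
  have "rec_eval (Comp r (map s [0..<m])) (map e [0..<k]) (F (\<lambda>i. G i e))" for e
    by (rule Comp[OF _ r]) (auto simp: list_all2_conv_all_nth s)
  then show ?thesis unfolding computable_def by blast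
qed

lemma computable_Suc [computable_intros]:
  assumes "computable k F" shows "computable k (\<lambda>e. Suc (F e))"
proof -
  have "computable 1 (\<lambda>e. Suc (e 0))"
    unfolding computable_def using Succ by (auto intro!: exI[of _ Succ])
  from computable_subst[OF this, of k "\<lambda>_. F"] assms show ?thesis by simp
qed

lemma computable_zero: "computable k (\<lambda>_. 0)"
  unfolding computable_def using Zero by blast

lemma computable_const [computable_intros]: "computable k (\<lambda>_. c)"
  by (induction c) (auto intro: computable_zero computable_Suc)

lemma map_case_nat_upt: "map (case_nat x e) [0..<Suc k] = x # map e [0..<k]"
  by (simp add: upt_conv_Cons map_Suc_upt[symmetric] del: upt_Suc)

text \<open>The basis of all loops below. In the step function, place 0 holds the counter, place 1
  the accumulator, and the outer variables follow, in the argument order of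
  \<open>PrimRec\<close>.\<close>

lemma computable_rec_nat [computable_intros]:
  assumes "computable k N" and "computable k A"
    and "computable (Suc (Suc k)) (\<lambda>e. G (\<lambda>i. e (Suc (Suc i))) (e 0) (e (Suc 0)))"
  shows "computable k (\<lambda>e. rec_nat (A e) (\<lambda>n y. G e n y) (N e))"
proof -
  obtain rA where rA: "\<And>e. rec_eval rA (map e [0..<k]) (A e)"
    using assms(2) unfolding computable_def by blast
  obtain rG where rG: "\<And>e. rec_eval rG (map e [0..<Suc (Suc k)])
      (G (\<lambda>i. e (Suc (Suc i))) (e 0) (e (Suc 0)))"
    using assms(3) unfolding computable_def by blast
  have rG': "rec_eval rG (n # y # map e [0..<k]) (G e n y)" for n y e
    using rG[of "case_nat n (case_nat y e)"] by (simp add: map_case_nat_upt del: upt_Suc)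
  have rec: "rec_eval (PrimRec rA rG) (n # map e [0..<k]) (rec_nat (A e) (G e) n)" for n e
  proof (induction n)
    case 0
    show ?case by (simp add: PrimRec_0 rA)
  next
    case (Suc n)
    show ?case using PrimRec_Suc[OF Suc rG'] by simp
  qed
  have "computable (Suc k) (\<lambda>e. rec_nat (A (\<lambda>i. e (Suc i))) (G (\<lambda>i. e (Suc i))) (e 0))"
    unfolding computable_def
  proof (intro exI allI)
    fix e :: "nat \<Rightarrow> nat"
    have "map e [0..<Suc k] = e 0 # map (\<lambda>i. e (Suc i)) [0..<k]"
      by (simp add: upt_conv_Cons map_Suc_upt[symmetric] o_def del: upt_Suc)
    then show "rec_eval (PrimRec rA rG) (map e [0..<Suc k])
        (rec_nat (A (\<lambda>i. e (Suc i))) (G (\<lambda>i. e (Suc i))) (e 0))"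
      using rec by metis
  qed
  moreover have "computable k (\<lambda>e. case_nat (N e) e i)" if "i < Suc k" for i
    using assms(1) that by (cases i) (auto intro: computable_var)
  ultimately show ?thesis
    using computable_subst[of "Suc k" _ k "\<lambda>i e. case_nat (N e) e i"] by fastforce
qed

lemma computable_shift:
  "computable k F \<Longrightarrow> computable (Suc k) (\<lambda>e. F (\<lambda>i. e (Suc i)))"
  using computable_subst[of k F "Suc k" "\<lambda>i e. e (Suc i)"] by (simp add: computable_var)

lemma computable_shift2:
  "computable k F \<Longrightarrow> computable (Suc (Suc k)) (\<lambda>e. F (\<lambda>i. e (Suc (Suc i))))"
  using computable_subst[of k F "Suc (Suc k)" "\<lambda>i e. e (Suc (Suc i))"] by (simp add: computable_var)

lemma computable_add [computable_intros]:
  assumes "computable k A" "computable k B"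
  shows "computable k (\<lambda>e. A e + B e)"
proof -
  have eq: "a + b = rec_nat b (\<lambda>_ y. Suc y) a" for a b :: nat by (induction a) auto
  show ?thesis unfolding eq by (intro computable_intros assms) auto
qed

lemma computable_mult [computable_intros]:
  assumes "computable k A" "computable k B"
  shows "computable k (\<lambda>e. A e * B e)"
proof -
  have eq: "a * b = rec_nat 0 (\<lambda>_ y. b + y) a" for a b :: nat by (induction a) auto
  show ?thesis unfolding eq by (intro computable_intros assms computable_shift2[OF assms(2)]) auto
qed

lemma computable_power [computable_intros]:
  assumes "computable k A" "computable k B"
  shows "computable k (\<lambda>e. A e ^ B e)"
proof -
  have eq: "a ^ b = rec_nat 1 (\<lambda>_ y. a * y) b" for a b :: nat by (induction b) auto
  show ?thesis unfolding eq by (intro computable_intros assms computable_shift2[OF assms(1)]) auto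
qed

lemma computable_fact [computable_intros]:
  assumes "computable k A"
  shows "computable k (\<lambda>e. fact (A e))"
proof -
  have eq: "fact a = rec_nat 1 (\<lambda>n y. Suc n * y) a" for a :: nat by (induction a) auto
  show ?thesis unfolding eq by (intro computable_intros assms) auto
qed

lemma computable_diff [computable_intros]:
  assumes "computable k A" "computable k B"
  shows "computable k (\<lambda>e. A e - B e)"
proof -
  have pred: "a - 1 = rec_nat 0 (\<lambda>n y. n) a" for a :: nat by (cases a) auto
  have eq: "a - b = rec_nat a (\<lambda>_ y. rec_nat 0 (\<lambda>n y. n) y) b" for a b :: nat
    unfolding pred[symmetric] by (induction b) auto
  show ?thesis unfolding eq by (intro computable_intros assms) auto
qed

lemma computable_sum [computable_intros]:
  assumes "computable k N" "computable (Suc k) (\<lambda>e. F (\<lambda>i. e (Suc i)) (e 0))"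
  shows "computable k (\<lambda>e. \<Sum>j<N e. F e j)"
proof -
  have eq: "(\<Sum>j<n. f j) = rec_nat 0 (\<lambda>j y. y + f j) n" for n and f :: "nat \<Rightarrow> nat"
    by (induction n) auto
  \<comment> \<open>The summand knows only its index, but the recursion also carries the accumulator
    at place 1; the renaming skips that place.\<close>
  have "computable (Suc (Suc k)) (\<lambda>e. F (\<lambda>i. e (Suc (Suc i))) (e 0))"
    using computable_subst[OF assms(2), of "Suc (Suc k)" "\<lambda>i e. e (if i = 0 then 0 else Suc i)"]
    by (simp add: computable_var)
  then show ?thesis unfolding eq by (intro computable_intros assms) auto
qed

section \<open>Decidable predicates and bounded quantifiers\<close>

lemma decidable_in_less [computable_intros]:
  assumes "computable k A" "computable k B"
  shows "decidable_in k (\<lambda>e. A e < B e)"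
proof -
  have eq: "of_bool (a < b) = (1::nat) - (1 - (b - a))" for a b :: nat by auto
  show ?thesis unfolding decidable_in_def eq by (intro computable_intros assms)
qed

lemma decidable_in_not [computable_intros]:
  assumes "decidable_in k P" shows "decidable_in k (\<lambda>e. \<not> P e)"
proof -
  have eq: "of_bool (\<not> p) = (1::nat) - of_bool p" for p by auto
  show ?thesis unfolding decidable_in_def eq
    by (intro computable_intros assms[unfolded decidable_in_def])
qed

lemma decidable_in_conj [computable_intros]:
  assumes "decidable_in k P" "decidable_in k Q" shows "decidable_in k (\<lambda>e. P e \<and> Q e)"
proof -
  have eq: "of_bool (p \<and> q) = (of_bool p :: nat) * of_bool q" for p q by auto
  show ?thesis unfolding decidable_in_def eq
    by (intro computable_intros assms[unfolded decidable_in_def])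
qed

lemma decidable_in_le [computable_intros]:
  assumes "computable k A" "computable k B"
  shows "decidable_in k (\<lambda>e. A e \<le> B e)"
  unfolding not_less[symmetric] by (intro computable_intros assms)

lemma decidable_in_eq [computable_intros]:
  assumes "computable k A" "computable k B"
  shows "decidable_in k (\<lambda>e. A e = B e)"
  unfolding eq_iff by (intro computable_intros assms)

lemma computable_if [computable_intros]:
  assumes "decidable_in k P" "computable k A" "computable k B"
  shows "computable k (\<lambda>e. if P e then A e else B e)"
proof -
  have eq: "(if p then a else b) = of_bool p * a + of_bool (\<not> p) * b" for p and a b :: nat by auto
  show ?thesis unfolding eq
    by (intro computable_intros assms assms(1)[unfolded decidable_in_def]
        decidable_in_not[OF assms(1), unfolded decidable_in_def])
qed

lemma decidable_in_bex [computable_intros]: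
  assumes "computable k N" "decidable_in (Suc k) (\<lambda>e. P (\<lambda>i. e (Suc i)) (e 0))"
  shows "decidable_in k (\<lambda>e. \<exists>n<N e. P e n)"
proof -
  have eq: "(\<exists>n<b. p n) \<longleftrightarrow> 0 < (\<Sum>n<b. of_bool (p n) :: nat)" for b :: nat and p
    by (auto simp: neq0_conv[symmetric] simp del: neq0_conv)
  show ?thesis unfolding eq
    by (intro computable_intros assms assms(2)[unfolded decidable_in_def])
qed

lemma decidable_in_ball [computable_intros]:
  assumes "computable k N" "decidable_in (Suc k) (\<lambda>e. P (\<lambda>i. e (Suc i)) (e 0))"
  shows "decidable_in k (\<lambda>e. \<forall>n<N e. P e n)"
proof -
  have eq: "(\<forall>n<b. p n) \<longleftrightarrow> \<not> (\<exists>n<b. \<not> p n)" for b :: nat and p by blast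
  show ?thesis unfolding eq by (intro computable_intros assms)
qed

section \<open>Division, set codes and pairing by bounded search\<close>

lemma computable_div [computable_intros]:
  assumes "computable k A" "computable k B"
  shows "computable k (\<lambda>e. A e div B e)"
proof -
  \<comment> \<open>At most one term is nonzero. For \<open>b = 0\<close> no \<open>q\<close> passes
    the test, and the result 0 agrees with \<open>a div 0\<close>.\<close>
  have eq: "a div b = (\<Sum>q<Suc a. if q * b \<le> a \<and> a < Suc q * b then q else 0)" for a b :: nat
  proof (cases "b = 0")
    case False
    then have "(q * b \<le> a \<and> a < Suc q * b) \<longleftrightarrow> q = a div b" for q
      by (metis div_nat_eqI dividend_less_div_times div_times_less_eq_dividend
          mult.commute mult_Suc mult_Suc_right not_gr_zero)
    then show ?thesis by (simp add: sum.delta less_Suc_eq_le del: sum.lessThan_Suc)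
  qed simp
  show ?thesis unfolding eq
    by (intro computable_intros assms computable_shift[OF assms(1)] computable_shift[OF assms(2)]) auto
qed

lemma computable_mod [computable_intros]:
  assumes "computable k A" "computable k B"
  shows "computable k (\<lambda>e. A e mod B e)"
  unfolding minus_div_mult_eq_mod[symmetric] by (intro computable_intros assms)

lemma decidable_in_even [computable_intros]:
  assumes "computable k A" shows "decidable_in k (\<lambda>e. even (A e))"
  unfolding even_iff_mod_2_eq_zero by (intro computable_intros assms)

lemma decidable_in_set_decode [computable_intros]:
  assumes "computable k A" "computable k B"
  shows "decidable_in k (\<lambda>e. A e \<in> set_decode (B e))"
  unfolding set_decode_def mem_Collect_eq by (intro computable_intros assms)

lemma computable_triangle [computable_intros]:
  assumes "computable k A" shows "computable k (\<lambda>e. triangle (A e))"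
  unfolding triangle_def by (intro computable_intros assms)

lemma computable_prod_encode [computable_intros]:
  assumes "computable k A" "computable k B"
  shows "computable k (\<lambda>e. prod_encode (A e, B e))"
  unfolding prod_encode_def prod.case by (intro computable_intros assms)

text \<open>Both components of a pair are at most its code, so they can be searched for below it; a
  sum with a single matching term performs the search.\<close>

lemma computable_fst_prod_decode [computable_intros]:
  assumes "computable k A" shows "computable k (\<lambda>e. fst (prod_decode (A e)))"
proof -
  have eq: "fst (prod_decode n) = (\<Sum>x<Suc n. if \<exists>y<Suc n. prod_encode (x, y) = n then x else 0)" for n
  proof -
    obtain x y where n: "n = prod_encode (x, y)" by (metis prod_decode_inverse surj_pair)
    have "(\<exists>y'<Suc n. prod_encode (x', y') = n) \<longleftrightarrow> x' = x" for x'
      using le_prod_encode_2[of y x] by (auto simp: n less_Suc_eq_le)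
    then show ?thesis using le_prod_encode_1[of x y]
      by (simp add: sum.delta less_Suc_eq_le n del: sum.lessThan_Suc)
  qed
  show ?thesis unfolding eq
    by (intro computable_intros assms computable_shift computable_shift2) auto
qed

lemma computable_snd_prod_decode [computable_intros]:
  assumes "computable k A" shows "computable k (\<lambda>e. snd (prod_decode (A e)))"
proof -
  have eq: "snd (prod_decode n) = (\<Sum>y<Suc n. if prod_encode (fst (prod_decode n), y) = n then y else 0)" for n
  proof -
    obtain x y where n: "n = prod_encode (x, y)" by (metis prod_decode_inverse surj_pair)
    show ?thesis using le_prod_encode_2[of y x]
      by (simp add: sum.delta less_Suc_eq_le n del: sum.lessThan_Suc)
  qed
  show ?thesis unfolding eq
    by (intro computable_intros assms computable_shift) auto
qed

lemma computable_funpow [computable_intros]: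
  assumes "computable k N" "computable k A" "computable (Suc k) (\<lambda>e. G (\<lambda>i. e (Suc i)) (e 0))"
  shows "computable k (\<lambda>e. (G e ^^ N e) (A e))"
proof -
  have eq: "(g ^^ n) a = rec_nat a (\<lambda>_ y. g y) n" for g :: "nat \<Rightarrow> nat" and n a
    by (induction n) auto
  have "computable (Suc (Suc k)) (\<lambda>e. G (\<lambda>i. e (Suc (Suc i))) (e (Suc 0)))"
    using computable_shift[OF assms(3)] .
  then show ?thesis unfolding eq by (intro computable_intros assms)
qed

lemma decidable_problemI:
  assumes "decidable_in (Suc 0) (\<lambda>e. D (e 0))" and "\<And>x. x \<in> I \<Longrightarrow> P x \<longleftrightarrow> D (enc x)"
  shows "decidable_problem enc I P"
proof -
  obtain r where r: "\<And>e. rec_eval r (map e [0..<Suc 0]) (of_bool (D (e 0)))"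
    using assms(1) unfolding decidable_in_def computable_def by blast
  have "rec_eval r [enc x] (if P x then 1 else 0)" if "x \<in> I" for x
    using r[of "\<lambda>_. enc x"] assms(2)[OF that] by (simp add: of_bool_def)
  then show ?thesis unfolding decidable_problem_def by blast
qed

section \<open>Zero-sum families of integer vectors\<close>

text \<open>The next index is chosen with a sign that drives the partial sum back towards 0.\<close>

lemma zero_sum_ordering:
  fixes w :: "'i \<Rightarrow> int"
  assumes "finite I" "\<And>i. i \<in> I \<Longrightarrow> \<bar>w i\<bar> \<le> M" "sum w I = 0" "k \<le> card I" "0 \<le> M"
  shows "\<exists>xs. distinct xs \<and> set xs \<subseteq> I \<and> length xs = k \<and>
    (\<forall>j\<le>k. \<bar>sum_list (map w (take j xs))\<bar> \<le> M)"
  using assms(4)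
proof (induction k)
  case 0
  then show ?case using assms(5) by auto
next
  case (Suc k)
  then obtain xs where xs: "distinct xs" "set xs \<subseteq> I" "length xs = k"
    and bound: "\<And>j. j \<le> k \<Longrightarrow> \<bar>sum_list (map w (take j xs))\<bar> \<le> M" by auto
  define s where "s = sum_list (map w xs)"
  have s: "\<bar>s\<bar> \<le> M" using bound[of k] xs(3) by (simp add: s_def)
  define R where "R = I - set xs"
  have sR: "sum w R = - s"
    using assms(1,3) xs by (simp add: R_def s_def sum_diff sum_list_distinct_conv_sum_set)
  have "card R > 0"
    using Suc.prems xs assms(1) by (simp add: R_def card_Diff_subset distinct_card)
  then have R: "finite R" "R \<noteq> {}" using card_gt_0_iff by blast+
  have "\<exists>i\<in>R. \<bar>s + w i\<bar> \<le> M"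
  proof (cases "s \<le> 0")
    case True
    have "\<exists>i\<in>R. w i \<ge> 0"
    proof (rule ccontr)
      assume "\<not> ?thesis"
      then have "sum w R < 0" using R sum_strict_mono[of R w "\<lambda>_. 0"] by (simp add: not_le)
      with sR True show False by simp
    qed
    then show ?thesis using True s assms(2) unfolding R_def by force
  next
    case False
    have "\<exists>i\<in>R. w i \<le> 0"
    proof (rule ccontr)
      assume "\<not> ?thesis"
      then have "sum w R > 0" using R by (intro sum_pos) auto
      with sR False show False by simp
    qed
    then show ?thesis using False s assms(2) unfolding R_def by force
  qed
  then obtain i where i: "i \<in> R" "\<bar>s + w i\<bar> \<le> M" by blast
  have "\<bar>sum_list (map w (take j (xs @ [i])))\<bar> \<le> M" if "j \<le> Suc k" for j
  proof (cases "j \<le> k")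
    case True
    then show ?thesis using bound[of j] xs(3) by simp
  next
    case False
    then have "j = Suc k" using that by simp
    then show ?thesis using i(2) xs(3) by (simp add: s_def)
  qed
  then show ?case using xs i(1) unfolding R_def
    by (intro exI[of _ "xs @ [i]"]) auto
qed

text \<open>In a balanced ordering, \<open>2 * M + 2\<close> partial sums lie among the
  \<open>2 * M + 1\<close> integers of absolute value at most \<open>M\<close>; the elements between
  two equal partial sums add up to 0.\<close>

lemma zero_sum_subset:
  fixes w :: "'i \<Rightarrow> int"
  assumes "finite I" "I \<noteq> {}" "\<And>i. i \<in> I \<Longrightarrow> \<bar>w i\<bar> \<le> int M" "sum w I = 0"
  shows "\<exists>A\<subseteq>I. A \<noteq> {} \<and> card A \<le> 2 * M + 1 \<and> sum w A = 0"
proof (cases "card I \<le> 2 * M + 1")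
  case True
  then show ?thesis using assms by blast
next
  case False
  let ?k = "2 * M + 1"
  obtain xs where xs: "distinct xs" "set xs \<subseteq> I" "length xs = ?k"
    and bound: "\<And>j. j \<le> ?k \<Longrightarrow> \<bar>sum_list (map w (take j xs))\<bar> \<le> int M"
    using zero_sum_ordering[OF assms(1,3,4), of ?k] False by auto
  let ?f = "\<lambda>j. sum_list (map w (take j xs))"
  have "\<not> inj_on ?f {..?k}"
  proof
    assume "inj_on ?f {..?k}"
    moreover have "?f ` {..?k} \<subseteq> {- int M..int M}" using bound by force
    ultimately have "card {..?k} \<le> card {- int M..int M}"
      using card_inj_on_le by blast
    then show False by simp
  qed
  then obtain i j where "i < j" "j \<le> ?k" "?f i = ?f j"
    unfolding inj_on_def by (metis atMost_iff linorder_neqE_nat)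
  let ?ys = "drop i (take j xs)"
  have "take i xs @ ?ys = take j xs"
    by (metis \<open>i < j\<close> append_take_drop_id min.strict_order_iff min.commute take_take)
  then have "?f j = ?f i + sum_list (map w ?ys)" by (metis map_append sum_list_append)
  then have "sum w (set ?ys) = 0"
    using xs(1) \<open>?f i = ?f j\<close> by (simp add: sum_list_distinct_conv_sum_set)
  moreover have "length ?ys = j - i" using xs(3) \<open>j \<le> ?k\<close> by simp
  moreover from this have "set ?ys \<noteq> {}" using \<open>i < j\<close> by (metis length_0_conv set_empty zero_less_diff nless_le)
  moreover have "set ?ys \<subseteq> I" using xs(2) by (meson in_set_dropD in_set_takeD subset_iff)
  ultimately show ?thesis
    using \<open>i < j\<close> \<open>j \<le> ?k\<close> card_length[of ?ys]
    by (intro exI[of _ "set ?ys"]) (simp del: set_empty)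
qed

lemma zero_sum_partition_1:
  fixes w :: "'i \<Rightarrow> int"
  assumes "finite I" "\<And>i. i \<in> I \<Longrightarrow> \<bar>w i\<bar> \<le> int M" "sum w I = 0"
  shows "\<exists>P. partition_on I P \<and> (\<forall>A\<in>P. card A \<le> 2 * M + 1 \<and> sum w A = 0)"
  using assms
proof (induction "card I" arbitrary: I rule: less_induct)
  case less
  show ?case
  proof (cases "I = {}")
    case True
    then show ?thesis by (intro exI[of _ "{}"]) (auto simp: partition_on_empty)
  next
    case False
    obtain A where A: "A \<subseteq> I" "A \<noteq> {}" "card A \<le> 2 * M + 1" "sum w A = 0"
      using zero_sum_subset[OF less.prems(1) False less.prems(2,3)] by blast
    have "sum w (I - A) = 0" using A less.prems(1,3) by (simp add: sum_diff)
    moreover have "card (I - A) < card I"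
      using A less.prems(1) by (intro psubset_card_mono) auto
    ultimately obtain P where P: "partition_on (I - A) P"
      "\<forall>A\<in>P. card A \<le> 2 * M + 1 \<and> sum w A = 0"
      using less.hyps[of "I - A"] less.prems by auto
    have "partition_on I (insert A P)"
      using P(1) A(1,2) unfolding partition_on_def by (auto simp: disjoint_def disjnt_def)
    then show ?thesis using P(2) A by blast
  qed
qed

text \<open>A block balanced in \<open>D\<close> coordinates sums to at most
  \<open>block_bound M D * M\<close> in the next one, so at most
  \<open>2 * (block_bound M D * M) + 1\<close> such blocks have to be merged to balance that
  coordinate too.\<close>

fun block_bound :: "nat \<Rightarrow> nat \<Rightarrow> nat" where
  "block_bound M 0 = 1"
| "block_bound M (Suc D) = (2 * (block_bound M D * M) + 1) * block_bound M D"

lemma block_bound_pos: "block_bound M D > 0"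
  by (induction D) auto

text \<open>The blocks found for the first \<open>D\<close> coordinates become the elements of a
  one-dimensional family, weighted by their sums in coordinate \<open>D\<close>. Merging them keeps
  the earlier coordinates balanced.\<close>

lemma zero_sum_partition:
  fixes w :: "'i \<Rightarrow> nat \<Rightarrow> int"
  assumes "finite I" "\<And>i k. i \<in> I \<Longrightarrow> k < D \<Longrightarrow> \<bar>w i k\<bar> \<le> int M"
    "\<And>k. k < D \<Longrightarrow> (\<Sum>i\<in>I. w i k) = 0"
  shows "\<exists>P. partition_on I P \<and>
    (\<forall>A\<in>P. card A \<le> block_bound M D \<and> (\<forall>k<D. (\<Sum>i\<in>A. w i k) = 0))"
  using assms(2,3)
proof (induction D)
  case 0
  have "partition_on I ((\<lambda>i. {i}) ` I)"
    unfolding partition_on_def disjoint_def by auto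
  then show ?case by (intro exI[of _ "(\<lambda>i. {i}) ` I"]) auto
next
  case (Suc D)
  let ?F = "block_bound M D"
  obtain P where P: "partition_on I P"
    and PA: "\<And>A. A \<in> P \<Longrightarrow> card A \<le> ?F" "\<And>A k. A \<in> P \<Longrightarrow> k < D \<Longrightarrow> (\<Sum>i\<in>A. w i k) = 0"
    using Suc.IH[OF Suc.prems(1)] Suc.prems(2) less_SucI by blast
  have U: "\<Union>P = I" and disj: "disjoint P" and sub: "\<And>A. A \<in> P \<Longrightarrow> A \<subseteq> I"
    using P by (auto simp: partition_on_def)
  have fin: "finite A" if "A \<in> P" for A using finite_subset[OF sub[OF that] assms(1)] .
  have finP: "finite P" using finite_UnionD[of P] U assms(1) by simp
  have dj: "A \<inter> B = {}" if "A \<in> P" "B \<in> P" "A \<noteq> B" for A B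
    using disj that unfolding disjoint_def by blast
  have sumU: "(\<Sum>i\<in>\<Union>Q. f i) = (\<Sum>A\<in>Q. \<Sum>i\<in>A. f i)" if "Q \<subseteq> P" for Q and f :: "'i \<Rightarrow> int"
  proof -
    have "\<forall>A\<in>Q. finite A" using that fin by blast
    moreover have "\<forall>A\<in>Q. \<forall>B\<in>Q. A \<noteq> B \<longrightarrow> A \<inter> B = {}" using that dj by blast
    ultimately show ?thesis by (simp add: sum.Union_disjoint)
  qed
  have "\<bar>\<Sum>i\<in>A. w i D\<bar> \<le> int (?F * M)" if "A \<in> P" for A
  proof -
    have "\<bar>\<Sum>i\<in>A. w i D\<bar> \<le> (\<Sum>i\<in>A. \<bar>w i D\<bar>)" by (rule sum_abs)
    also have "\<dots> \<le> int (card A) * int M"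
      using Suc.prems(1) sub[OF that] by (intro sum_bounded_above) auto
    also have "\<dots> \<le> int ?F * int M" using PA(1)[OF that] by (intro mult_right_mono) auto
    finally show ?thesis by simp
  qed
  moreover have "(\<Sum>A\<in>P. \<Sum>i\<in>A. w i D) = 0" using Suc.prems(2)[of D] sumU[of P] U by simp
  ultimately obtain Q where Q: "partition_on P Q"
    and QB: "\<And>B. B \<in> Q \<Longrightarrow> card B \<le> 2 * (?F * M) + 1"
      "\<And>B. B \<in> Q \<Longrightarrow> (\<Sum>A\<in>B. \<Sum>i\<in>A. w i D) = 0"
    using zero_sum_partition_1[of P "\<lambda>A. \<Sum>i\<in>A. w i D" "?F * M"] finP by blast
  have Qsub: "B \<subseteq> P" if "B \<in> Q" for B using Q that by (auto simp: partition_on_def)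
  have "partition_on I (Union ` Q)"
    unfolding partition_on_def
  proof (intro conjI)
    show "\<Union> (Union ` Q) = I" using Q U unfolding partition_on_def by auto
    show "{} \<notin> Union ` Q"
    proof
      assume "{} \<in> Union ` Q"
      then obtain B where B: "B \<in> Q" "\<Union>B = {}" by auto
      have "B \<noteq> {}" using B(1) partition_onD3[OF Q] by metis
      then obtain A where "A \<in> B" by blast
      then have "A = {}" "A \<in> P" using B Qsub by auto
      then show False using partition_onD3[OF P] by simp
    qed
    show "disjoint (Union ` Q)"
    proof (rule disjointI)
      fix a b assume "a \<in> Union ` Q" "b \<in> Union ` Q" "a \<noteq> b"
      then obtain A B where AB: "A \<in> Q" "B \<in> Q" "a = \<Union>A" "b = \<Union>B" "A \<noteq> B" by blast
      then have "A \<inter> B = {}" using Q unfolding partition_on_def disjoint_def by blast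
      then show "a \<inter> b = {}" using AB Qsub dj by blast
    qed
  qed
  moreover have "card (\<Union>B) \<le> block_bound M (Suc D)" if "B \<in> Q" for B
  proof -
    have "card (\<Union>B) \<le> sum card B" by (rule card_Union_le_sum_card)
    also have "\<dots> \<le> card B * ?F"
      using PA(1) Qsub[OF that] sum_bounded_above[of B card ?F] by auto
    also have "\<dots> \<le> (2 * (?F * M) + 1) * ?F" using QB(1)[OF that] by (rule mult_right_mono) simp
    finally show ?thesis by simp
  qed
  moreover have "(\<Sum>i\<in>\<Union>B. w i k) = 0" if "B \<in> Q" "k < Suc D" for B k
    using QB(2)[OF that(1)] PA(2) Qsub[OF that(1)] that(2) sumU[OF Qsub[OF that(1)]]
    by (cases "k = D") (auto simp: less_Suc_eq subset_iff)
  ultimately show ?case by blast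
qed

section \<open>Walks in integer VASS\<close>

locale walks =
  fixes T :: "'e set" and src tgt :: "'e \<Rightarrow> 's" and Q :: "'s set" and n :: nat
  assumes finite_Q: "finite Q" and card_Q: "card Q \<le> n"
    and src_Q: "e \<in> T \<Longrightarrow> src e \<in> Q" and tgt_Q: "e \<in> T \<Longrightarrow> tgt e \<in> Q"
begin

fun walk :: "'s \<Rightarrow> 'e list \<Rightarrow> 's \<Rightarrow> bool" where
  "walk p [] q \<longleftrightarrow> p = q"
| "walk p (e # es) q \<longleftrightarrow> e \<in> T \<and> src e = p \<and> walk (tgt e) es q"

definition visited :: "'s \<Rightarrow> 'e list \<Rightarrow> 's set" where
  "visited p es = insert p (tgt ` set es)"

lemma walk_append: "walk p (es @ fs) q \<longleftrightarrow> (\<exists>r. walk p es r \<and> walk r fs q)"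
  by (induction es arbitrary: p) auto

lemma walk_subset: "walk p es q \<Longrightarrow> set es \<subseteq> T"
  by (induction es arbitrary: p) auto

lemma walk_visited:
  assumes "walk p es q" "s \<in> visited p es"
  obtains es1 es2 where "es = es1 @ es2" "walk p es1 s" "walk s es2 q"
proof -
  have "\<exists>es1 es2. es = es1 @ es2 \<and> walk p es1 s \<and> walk s es2 q"
    using assms
  proof (induction es arbitrary: p)
    case Nil
    then show ?case by (simp add: visited_def)
  next
    case (Cons e es)
    show ?case
    proof (cases "s = p")
      case True
      then show ?thesis using Cons.prems by (intro exI[of _ "[]"] exI[of _ "e # es"]) auto
    next
      case False
      then have "s \<in> visited (tgt e) es" using Cons.prems by (auto simp: visited_def)
      moreover have "walk (tgt e) es q" using Cons.prems by simp
      ultimately obtain es1 es2 where "es = es1 @ es2" "walk (tgt e) es1 s" "walk s es2 q"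
        using Cons.IH by blast
      then show ?thesis using Cons.prems by (intro exI[of _ "e # es1"] exI[of _ es2]) auto
    qed
  qed
  then show thesis using that by blast
qed

lemma visited_subset: "walk p es q \<Longrightarrow> p \<in> Q \<Longrightarrow> visited p es \<subseteq> Q"
  using walk_subset tgt_Q unfolding visited_def by blast

text \<open>A closed walk can be spliced in wherever its base state is visited, and splicing never
  loses visited states. Only the multiset of edges is recorded, since effects do not depend on the
  order.\<close>

lemma walk_insert_cycles:
  assumes "walk p s q" "\<And>c. c \<in> set C \<Longrightarrow> \<exists>x\<in>visited p s. walk x c x"
  shows "\<exists>es. walk p es q \<and> mset es = mset (s @ concat C)"
  using assms(2)
proof (induction C)
  case Nil
  then show ?case using assms(1) by auto
next
  case (Cons c C)
  then obtain es where es: "walk p es q" "mset es = mset (s @ concat C)" by auto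
  obtain x where x: "x \<in> visited p s" "walk x c x" using Cons.prems by auto
  have "set s \<subseteq> set es" using mset_eq_setD[OF es(2)] by auto
  then have "x \<in> visited p es" using x(1) by (auto simp: visited_def)
  then obtain es1 es2 where split: "es = es1 @ es2" "walk p es1 x" "walk x es2 q"
    using walk_visited es(1) by metis
  then have "walk p (es1 @ c @ es2) q" using x(2) unfolding walk_append by blast
  moreover have "mset (es1 @ c @ es2) = mset (s @ concat (c # C))" using es(2) split(1) by simp
  ultimately show ?case by blast
qed

text \<open>The induction over the edges of the walk keeps a skeleton \<open>s\<close> followed by a path \<open>r\<close> without
  repeated states that visits no state outside the skeleton. Reaching a new state extends the skeleton by
  the whole path; returning to a state on the path cuts off a cycle.\<close>

lemma walk_skeleton:
  assumes "walk p es q" "p \<in> Q"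
  shows "\<exists>s C. walk p s q \<and> length s \<le> n * (n + 2) \<and> mset es = mset (s @ concat C) \<and>
    (\<forall>c\<in>set C. length c \<le> n \<and> (\<exists>x\<in>visited p s. walk x c x))"
proof -
  \<comment> \<open>A new state costs the skeleton at most \<open>n\<close> edges: a path without
    repeated states has fewer than \<open>n\<close>, and one edge leads to the new state.\<close>
  have "\<exists>s x r C. walk p s x \<and> walk x r q \<and> distinct (x # map tgt r) \<and>
      visited x r \<subseteq> visited p s \<and> length s \<le> card (visited p s) * (n + 1) \<and>
      mset es = mset (s @ r @ concat C) \<and>
      (\<forall>c\<in>set C. length c \<le> n \<and> (\<exists>y\<in>visited p s. walk y c y))"
    using assms(1)
  proof (induction es arbitrary: q rule: rev_induct)
    case Nil
    then show ?case by (intro exI[of _ "[]"] exI[of _ q]) (auto simp: visited_def)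
  next
    case (snoc e es)
    let ?q = "src e"
    have e: "e \<in> T" "tgt e = q" "walk p es ?q" using snoc.prems by (auto simp: walk_append)
    obtain s x r C where IH: "walk p s x" "walk x r ?q" "distinct (x # map tgt r)"
      "visited x r \<subseteq> visited p s" "length s \<le> card (visited p s) * (n + 1)"
      "mset es = mset (s @ r @ concat C)"
      and C: "\<forall>c\<in>set C. length c \<le> n \<and> (\<exists>y\<in>visited p s. walk y c y)"
      using snoc.IH[OF e(3)] by blast
    have sub: "visited p s \<subseteq> Q" using visited_subset IH(1) assms(2) by blast
    have fin: "finite (visited p s)" using sub finite_Q finite_subset by blast
    have "card (visited x r) = Suc (length r)"
      using distinct_card[OF IH(3)] by (simp add: visited_def)
    then have r: "length r < n" using card_mono[OF finite_Q] card_Q IH(4) sub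
      by (metis Suc_le_eq order_trans)
    consider "q \<notin> visited p s" | "q \<in> visited x r" | "q \<in> visited p s" "q \<notin> visited x r" by blast
    then show ?case
    proof cases
      case 1
      let ?s = "s @ r @ [e]"
      have vis: "insert q (visited p s) \<subseteq> visited p ?s" using e by (auto simp: visited_def)
      have w: "walk p ?s q" using IH(1,2) e by (auto simp: walk_append)
      have "Suc (card (visited p s)) = card (insert q (visited p s))" using 1 fin by simp
      also have "\<dots> \<le> card (visited p ?s)"
        using vis by (intro card_mono) (auto simp: visited_def)
      finally have "Suc (card (visited p s)) * (n + 1) \<le> card (visited p ?s) * (n + 1)"
        by (rule mult_le_mono1)
      then have "length ?s \<le> card (visited p ?s) * (n + 1)" using IH(5) r by simp
      moreover have "\<forall>c\<in>set C. length c \<le> n \<and> (\<exists>y\<in>visited p ?s. walk y c y)" using C vis by blast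
      moreover have "visited q [] \<subseteq> visited p ?s" using vis by (auto simp: visited_def)
      ultimately show ?thesis using w IH(6)
        by (intro exI[of _ ?s] exI[of _ q] exI[of _ "[]"] exI[of _ C]) auto
    next
      case 2
      then obtain r1 r2 where r12: "r = r1 @ r2" "walk x r1 q" "walk q r2 ?q"
        using walk_visited IH(2) by metis
      have "walk q (r2 @ [e]) q" using r12 e by (auto simp: walk_append)
      moreover have "length (r2 @ [e]) \<le> n" using r r12 by simp
      moreover have "visited x r1 \<subseteq> visited p s" "q \<in> visited p s"
        using IH(4) 2 r12 by (auto simp: visited_def)
      ultimately show ?thesis using IH r12 C
        by (intro exI[of _ s] exI[of _ x] exI[of _ r1] exI[of _ "(r2 @ [e]) # C"]) auto
    next
      case 3
      have "walk x (r @ [e]) q" using IH(2) e by (auto simp: walk_append)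
      moreover have "visited x (r @ [e]) \<subseteq> visited p s"
        using IH(4) 3 e by (auto simp: visited_def)
      moreover have "distinct (x # map tgt (r @ [e]))" using IH(3) 3 e by (auto simp: visited_def)
      ultimately show ?thesis using IH C
        by (intro exI[of _ s] exI[of _ x] exI[of _ "r @ [e]"] exI[of _ C]) auto
    qed
  qed
  then obtain s x r C where *: "walk p s x" "walk x r q" "distinct (x # map tgt r)"
      "visited x r \<subseteq> visited p s" "length s \<le> card (visited p s) * (n + 1)"
      "mset es = mset (s @ r @ concat C)"
      "\<forall>c\<in>set C. length c \<le> n \<and> (\<exists>y\<in>visited p s. walk y c y)" by blast
  have sub: "visited p s \<subseteq> Q" using visited_subset *(1) assms(2) by blast
  have cn: "card (visited p s) \<le> n" using card_mono[OF finite_Q sub] card_Q by simp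
  have "card (visited x r) = Suc (length r)"
    using distinct_card[OF *(3)] by (simp add: visited_def)
  then have "length r < n"
    using card_mono[OF finite_Q] card_Q *(4) sub by (metis Suc_le_eq order_trans)
  moreover have "length s \<le> n * (n + 1)" using *(5) mult_le_mono1[OF cn, of "n + 1"] by simp
  \<comment> \<open>The path left over at the end, of fewer than \<open>n\<close> edges, joins the
    skeleton and turns \<open>n * (n + 1)\<close> into \<open>n * (n + 2)\<close>.\<close>
  ultimately have "length (s @ r) \<le> n * (n + 2)" by simp
  moreover have "visited p s \<subseteq> visited p (s @ r)" by (auto simp: visited_def)
  ultimately show ?thesis using * by (intro exI[of _ "s @ r"] exI[of _ C]) (fastforce simp: walk_append)
qed

end

section \<open>Effects of walks, and their reduction by dropping zero-sum blocks\<close>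

definition eff :: "('e \<Rightarrow> nat \<Rightarrow> int) \<Rightarrow> 'e list \<Rightarrow> nat \<Rightarrow> int" where
  "eff lab es k = (\<Sum>e\<leftarrow>es. lab e k)"

text \<open>The summands account for a skeleton of at most \<open>n * (n + 2)\<close> edges, a cycle
  of at most \<open>n\<close> edges, the fixed part \<open>w\<close> and an entry of the direction
  \<open>h\<close>.\<close>

definition item_bound :: "nat \<Rightarrow> nat \<Rightarrow> nat \<Rightarrow> nat" where
  "item_bound n M W = n * (n + 2) * M + n * M + W + 1"

definition period :: "nat \<Rightarrow> nat \<Rightarrow> nat \<Rightarrow> nat \<Rightarrow> nat" where
  "period n M D W = fact (block_bound (item_bound n M W) D)"

text \<open>Let \<open>F\<close> be the block bound. The block of the skeleton takes at most
  \<open>F\<close> of the copies of \<open>- h\<close>; the others occupy at least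
  \<open>F * period\<close> blocks, so one of the \<open>F\<close> possible counts occurs in at
  least \<open>period\<close> blocks.\<close>

definition threshold :: "nat \<Rightarrow> nat \<Rightarrow> nat \<Rightarrow> nat \<Rightarrow> nat" where
  "threshold n M D W =
    (block_bound (item_bound n M W) D * period n M D W + 1) * block_bound (item_bound n M W) D"

lemma period_pos: "0 < period n M D W"
  by (simp add: period_def)

lemma period_le_threshold: "period n M D W \<le> threshold n M D W"
proof -
  define F where "F = block_bound (item_bound n M W) D"
  have "1 * (1 * period n M D W) \<le> F * (F * period n M D W)"
    using block_bound_pos[of "item_bound n M W" D] unfolding F_def by (intro mult_le_mono) auto
  also have "\<dots> \<le> threshold n M D W" by (simp add: threshold_def F_def[symmetric] algebra_simps)
  finally show ?thesis by simp
qed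

locale labelled_walks = walks T src tgt Q n
  for T :: "'e set" and src tgt :: "'e \<Rightarrow> 's" and Q :: "'s set" and n :: nat +
  fixes lab :: "'e \<Rightarrow> nat \<Rightarrow> int" and D M :: nat
  assumes lab_bound: "e \<in> T \<Longrightarrow> k < D \<Longrightarrow> \<bar>lab e k\<bar> \<le> int M"
begin

lemma eff_bound: "set es \<subseteq> T \<Longrightarrow> k < D \<Longrightarrow> \<bar>eff lab es k\<bar> \<le> int (length es * M)"
proof (induction es)
  case (Cons e es)
  then have "\<bar>lab e k\<bar> \<le> int M" "\<bar>eff lab es k\<bar> \<le> int (length es * M)" using lab_bound by auto
  then show ?case by (simp add: eff_def algebra_simps)
qed (simp add: eff_def)

lemma eff_mset_cong: "mset es = mset fs \<Longrightarrow> eff lab es k = eff lab fs k"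
  unfolding eff_def by (metis mset_map sum_mset_sum_list)

lemma eff_append: "eff lab (es @ fs) k = eff lab es k + eff lab fs k"
  by (simp add: eff_def)

lemma eff_concat: "eff lab (concat C) k = (\<Sum>c\<leftarrow>C. eff lab c k)"
  by (induction C) (simp_all add: eff_def)

text \<open>The items to be split into zero-sum blocks are the skeleton minus the target \<open>w\<close> (\<open>Inl 0\<close>), the
  cycles (\<open>Inl (Suc i)\<close>), and \<open>x\<close> copies of \<open>- h\<close> (elements \<open>Inr j\<close>). Any set \<open>R\<close> of blocks not
  containing \<open>Inl 0\<close> may be dropped.\<close>

lemma walk_items:
  assumes "walk p es q" "p \<in> Q" "\<And>k. k < D \<Longrightarrow> eff lab es k = w k + int x * h k"
    "\<And>k. k < D \<Longrightarrow> \<bar>w k\<bar> \<le> int W" "\<And>k. k < D \<Longrightarrow> \<bar>h k\<bar> \<le> 1"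
  obtains m :: nat and P where "partition_on ({..m} <+> {..<x}) P"
    "\<forall>A\<in>P. card A \<le> block_bound (item_bound n M W) D"
    "\<forall>R. R \<subseteq> P \<longrightarrow> Inl 0 \<notin> \<Union>R \<longrightarrow>
      (\<exists>es'. walk p es' q \<and> length es' \<le> n * (n + 2) + card (({..m} <+> {..<x}) - \<Union>R) * n \<and>
        (\<forall>k<D. eff lab es' k = w k + int (x - card (Inr -` \<Union>R)) * h k))"
proof -
  obtain s C where s: "walk p s q" "length s \<le> n * (n + 2)" "mset es = mset (s @ concat C)"
    and C: "\<And>c. c \<in> set C \<Longrightarrow> length c \<le> n \<and> (\<exists>x\<in>visited p s. walk x c x)"
    using walk_skeleton[OF assms(1,2)] by blast
  define m where "m = length C"
  define v where "v = case_sum (case_nat (\<lambda>k. eff lab s k - w k) (\<lambda>i. eff lab (C ! i))) (\<lambda>_::nat. \<lambda>k. - h k)"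
  let ?I = "{..m} <+> {..<x}"
  have v_simps: "v (Inl 0) k = eff lab s k - w k" "v (Inl (Suc i)) k = eff lab (C ! i) k"
    "v (Inr j) k = - h k" for k i j by (simp_all add: v_def)
  have sum_S: "(\<Sum>i\<in>S. v i k) = eff lab s k - w k + (\<Sum>i\<in>{i. Inl (Suc i) \<in> S}. eff lab (C ! i) k)
      - int (card (Inr -` S)) * h k" if S: "S \<subseteq> ?I" "Inl 0 \<in> S" for S k
  proof -
    have fin: "finite (Inl -` S)" "finite (Inr -` S)"
      using S by (auto intro: finite_subset[of _ "{..m}"] finite_subset[of _ "{..<x}"])
    have "S = Inl -` S <+> Inr -` S"
    proof (rule Set.set_eqI)
      show "y \<in> S \<longleftrightarrow> y \<in> Inl -` S <+> Inr -` S" for y by (cases y) auto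
    qed
    then have split: "(\<Sum>i\<in>S. v i k) = (\<Sum>i\<in>Inl -` S. v (Inl i) k) + (\<Sum>i\<in>Inr -` S. v (Inr i) k)"
      using sum.Plus[OF fin, of "\<lambda>i. v i k"] by (simp add: comp_def)
    have Inl_S: "Inl -` S = insert 0 (Suc ` {i. Inl (Suc i) \<in> S})"
    proof (rule Set.set_eqI)
      show "y \<in> Inl -` S \<longleftrightarrow> y \<in> insert 0 (Suc ` {i. Inl (Suc i) \<in> S})" for y
        using S(2) by (cases y) auto
    qed
    have "finite {i. Inl (Suc i) \<in> S}"
      using finite_vimageI[OF fin(1), of Suc] by (simp add: vimage_def)
    then have "(\<Sum>i\<in>Inl -` S. v (Inl i) k) = v (Inl 0) k + (\<Sum>i\<in>Suc ` {i. Inl (Suc i) \<in> S}. v (Inl i) k)"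
      unfolding Inl_S by (subst sum.insert) auto
    then show ?thesis unfolding split by (simp add: v_simps sum.reindex)
  qed
  have bound: "\<bar>v i k\<bar> \<le> int (item_bound n M W)" if "i \<in> ?I" "k < D" for i k
  proof -
    have "i = Inl 0 \<or> (\<exists>j<m. i = Inl (Suc j)) \<or> (\<exists>j. i = Inr j)"
    proof (cases i)
      case (Inl a)
      then show ?thesis using that(1) by (cases a) auto
    qed simp
    then consider "i = Inl 0" | j where "i = Inl (Suc j)" "j < m" | j where "i = Inr j" by blast
    then show ?thesis
    proof cases
      case 1
      have "\<bar>eff lab s k\<bar> \<le> int (length s * M)" using eff_bound walk_subset s(1) that(2) by blast
      also have "\<dots> \<le> int (n * (n + 2) * M)" using s(2) by (intro of_nat_mono mult_le_mono1)
      finally have "\<bar>eff lab s k - w k\<bar> \<le> int (n * (n + 2) * M) + int W"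
        using assms(4)[OF that(2)] by linarith
      then show ?thesis unfolding 1 v_simps item_bound_def by linarith
    next
      case 2
      then have c: "C ! j \<in> set C" by (simp add: m_def)
      then have "set (C ! j) \<subseteq> T" using C walk_subset by blast
      then have "\<bar>eff lab (C ! j) k\<bar> \<le> int (length (C ! j) * M)" using eff_bound that(2) by blast
      also have "\<dots> \<le> int (n * M)" using C[OF c] by (intro of_nat_mono mult_le_mono1) auto
      finally show ?thesis unfolding 2 v_simps item_bound_def by linarith
    next
      case 3
      show ?thesis using assms(5)[OF that(2)] unfolding 3 v_simps item_bound_def by linarith
    qed
  qed
  have "{i. Inl (Suc i) \<in> ?I} = {..<m}" "Inr -` ?I = {..<x}" by auto
  then have sum_I: "(\<Sum>i\<in>?I. v i k) = 0" if "k < D" for k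
  proof -
    have "(\<Sum>i\<in>{..<m}. eff lab (C ! i) k) = eff lab (concat C) k"
      by (simp add: eff_concat m_def sum_list_sum_nth atLeast0LessThan)
    then show ?thesis
      using sum_S[OF subset_refl InlI[OF atMost_iff[THEN iffD2, OF le0]], of k] assms(3)[OF that] eff_mset_cong[OF s(3), of k]
        \<open>{i. Inl (Suc i) \<in> ?I} = {..<m}\<close> \<open>Inr -` ?I = {..<x}\<close> by (simp add: eff_append)
  qed
  obtain P where P: "partition_on ?I P"
    and PA: "\<And>A. A \<in> P \<Longrightarrow> card A \<le> block_bound (item_bound n M W) D"
      "\<And>A k. A \<in> P \<Longrightarrow> k < D \<Longrightarrow> (\<Sum>i\<in>A. v i k) = 0"
    using zero_sum_partition[of ?I D v "item_bound n M W"] bound sum_I by auto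
  have U: "\<Union>P = ?I" using P by (simp add: partition_on_def)
  have keep: "\<exists>es'. walk p es' q \<and> length es' \<le> n * (n + 2) + card (?I - \<Union>R) * n \<and>
        (\<forall>k<D. eff lab es' k = w k + int (x - card (Inr -` \<Union>R)) * h k)"
    if R: "R \<subseteq> P" "Inl 0 \<notin> \<Union>R" for R
  proof -
    let ?S = "?I - \<Union>R"
    let ?J = "{i. Inl (Suc i) \<in> ?S}"
    have finI: "finite ?I" by simp
    have URI: "\<Union>R \<subseteq> ?I" using R U by blast
    have zero_R: "(\<Sum>i\<in>\<Union>R. v i k) = 0" if "k < D" for k
    proof -
      have "\<forall>A\<in>R. finite A" using URI finI by (meson Union_upper finite_subset)
      moreover have "\<forall>A\<in>R. \<forall>B\<in>R. A \<noteq> B \<longrightarrow> A \<inter> B = {}"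
        using R(1) partition_onD2[OF P] unfolding disjoint_def by blast
      ultimately have "(\<Sum>i\<in>\<Union>R. v i k) = (\<Sum>A\<in>R. \<Sum>i\<in>A. v i k)"
        by (simp add: sum.Union_disjoint)
      also have "\<dots> = 0" using PA(2) R(1) that by (intro sum.neutral) blast
      finally show ?thesis .
    qed
    \<comment> \<open>All items together and each dropped block have sum zero, hence so do the kept
      items; solved for the kept skeleton and cycles, this is the claimed effect.\<close>
    have zero_S: "(\<Sum>i\<in>?S. v i k) = 0" if "k < D" for k
      using sum_diff[OF finI URI, of "\<lambda>i. v i k"] zero_R[OF that] sum_I[OF that] by simp
    have J: "?J \<subseteq> {..<m}" by auto
    then have finJ: "finite ?J" using finite_subset by blast
    let ?C = "map ((!) C) (sorted_list_of_set ?J)"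
    have setC: "set ?C \<subseteq> set C" using J finJ by (auto simp: m_def)
    then obtain es' where es': "walk p es' q" "mset es' = mset (s @ concat ?C)"
      using walk_insert_cycles[OF s(1), of ?C] C by blast
    have "length (concat ?C) \<le> card ?J * n"
    proof -
      have "length (concat ?C) = (\<Sum>i\<in>?J. length (C ! i))"
        using finJ by (simp add: length_concat comp_def sum_list_distinct_conv_sum_set)
      also have "\<dots> \<le> of_nat (card ?J) * n"
      proof (rule sum_bounded_above)
        fix i assume "i \<in> ?J"
        then have "C ! i \<in> set C" using J by (intro nth_mem) (auto simp: m_def)
        then show "length (C ! i) \<le> n" using C by blast
      qed
      finally show ?thesis by simp
    qed
    moreover have "card ?J \<le> card ?S"
    proof -
      have "card ?J = card ((\<lambda>i. Inl (Suc i)) ` ?J :: (nat + nat) set)"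
        by (intro card_image[symmetric] injI inj_onI) simp
      also have "\<dots> \<le> card ?S" by (intro card_mono) auto
      finally show ?thesis .
    qed
    ultimately have "length (concat ?C) \<le> card ?S * n" using mult_le_mono1 order_trans by blast
    then have len: "length es' \<le> n * (n + 2) + card ?S * n"
      using mset_eq_length[OF es'(2)] s(2) by simp
    have S: "?S \<subseteq> ?I" "Inl 0 \<in> ?S" using R(2) by auto
    have "Inr -` ?S = {..<x} - Inr -` \<Union>R" by auto
    moreover have "Inr -` \<Union>R \<subseteq> {..<x}" using URI by auto
    ultimately have cardR: "card (Inr -` ?S) = x - card (Inr -` \<Union>R)"
      by (simp add: card_Diff_subset finite_subset[of _ "{..<x}"])
    have "eff lab es' k = w k + int (x - card (Inr -` \<Union>R)) * h k" if "k < D" for k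
    proof -
      have "eff lab (concat ?C) k = (\<Sum>i\<in>?J. eff lab (C ! i) k)"
        using finJ by (simp add: eff_concat comp_def sum_list_distinct_conv_sum_set)
      then have "eff lab es' k = eff lab s k + (\<Sum>i\<in>?J. eff lab (C ! i) k)"
        using eff_mset_cong[OF es'(2), of k] by (simp add: eff_append)
      then show ?thesis using sum_S[OF S, of k] zero_S[OF that] cardR by simp
    qed
    then show ?thesis using es'(1) len by blast
  qed
  show thesis by (rule that[OF P]) (use PA(1) keep in blast)+
qed

lemma short_walk:
  assumes "walk p es q" "p \<in> Q" "\<And>k. k < D \<Longrightarrow> \<bar>eff lab es k\<bar> \<le> int W"
  shows "\<exists>es'. walk p es' q \<and> length es' \<le> n * (n + 2) + block_bound (item_bound n M W) D * n \<and>
    (\<forall>k<D. eff lab es' k = eff lab es k)"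
proof -
  obtain m :: nat and P where P: "partition_on ({..m} <+> {..<0::nat}) P"
    and PA: "\<forall>A\<in>P. card A \<le> block_bound (item_bound n M W) D"
    and keep: "\<forall>R. R \<subseteq> P \<longrightarrow> Inl 0 \<notin> \<Union>R \<longrightarrow>
      (\<exists>es'. walk p es' q \<and> length es' \<le> n * (n + 2) + card (({..m} <+> {..<0::nat}) - \<Union>R) * n \<and>
        (\<forall>k<D. eff lab es' k = eff lab es k + int (0 - card (Inr -` \<Union>R)) * 0))"
    by (rule walk_items[OF assms(1,2), of "eff lab es" 0 "\<lambda>_. 0" W]) (use assms(3) in simp_all)
  have "Inl 0 \<in> \<Union>P" unfolding partition_onD1[OF P, symmetric] by auto
  then obtain A where A: "A \<in> P" "Inl 0 \<in> A" by blast
  have "Inl 0 \<notin> \<Union>(P - {A})"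
    using A partition_onD2[OF P] unfolding disjoint_def by blast
  then obtain es' where es': "walk p es' q" "\<forall>k<D. eff lab es' k = eff lab es k"
    "length es' \<le> n * (n + 2) + card (({..m} <+> {..<0::nat}) - \<Union>(P - {A})) * n"
    using keep[rule_format, of "P - {A}"] by auto
  have "A \<subseteq> {..m} <+> {..<0}" using A(1) partition_onD1[OF P] by blast
  then have "finite A" by (rule finite_subset) simp
  moreover have "({..m} <+> {..<0}) - \<Union>(P - {A}) \<subseteq> A" using partition_onD1[OF P] by blast
  ultimately have "card (({..m} <+> {..<0}) - \<Union>(P - {A})) \<le> block_bound (item_bound n M W) D"
    using PA[rule_format, OF A(1)] card_mono order_trans by blast
  then show ?thesis using es' mult_le_mono1 by (meson add_left_mono order_trans)
qed

text \<open>A block containing \<open>g\<close> copies of \<open>- h\<close> has \<open>g\<close> at most the block bound, hence \<open>g\<close> divides the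
  period, and by the pigeonhole principle some \<open>g\<close> occurs in \<open>period div g\<close> blocks.\<close>

lemma walk_reduce:
  assumes "walk p es q" "p \<in> Q" "\<And>k. k < D \<Longrightarrow> eff lab es k = w k + int x * h k"
    "\<And>k. k < D \<Longrightarrow> \<bar>w k\<bar> \<le> int W" "\<And>k. k < D \<Longrightarrow> \<bar>h k\<bar> \<le> 1" "x \<ge> threshold n M D W"
  shows "\<exists>es'. walk p es' q \<and> (\<forall>k<D. eff lab es' k = w k + int (x - period n M D W) * h k)"
proof -
  define F where "F = block_bound (item_bound n M W) D"
  have F: "F > 0" by (simp add: F_def block_bound_pos)
  obtain m :: nat and P where P: "partition_on ({..m} <+> {..<x}) P"
    and PA: "\<forall>A\<in>P. card A \<le> F"
    and keep: "\<forall>R. R \<subseteq> P \<longrightarrow> Inl 0 \<notin> \<Union>R \<longrightarrow>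
      (\<exists>es'. walk p es' q \<and> length es' \<le> n * (n + 2) + card (({..m} <+> {..<x}) - \<Union>R) * n \<and>
        (\<forall>k<D. eff lab es' k = w k + int (x - card (Inr -` \<Union>R)) * h k))"
    unfolding F_def by (rule walk_items[OF assms(1-5)])
  have fin: "finite A" if "A \<in> P" for A
  proof -
    have "A \<subseteq> {..m} <+> {..<x}" using that partition_onD1[OF P] by blast
    then show ?thesis by (rule finite_subset) simp
  qed
  have finP: "finite P" using finite_UnionD[of P] partition_onD1[OF P, symmetric] by simp
  have card_Inr: "card (Inr -` A) \<le> F" "finite (Inr -` A)" if "A \<in> P" for A
  proof -
    have "card (Inr -` A) \<le> card A" using card_inj_on_le[of Inr "Inr -` A" A] fin[OF that] by auto
    then show "card (Inr -` A) \<le> F" using PA that by (meson order_trans)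
    show "finite (Inr -` A)" using fin[OF that] by (simp add: finite_vimageI)
  qed
  have "Inl 0 \<in> \<Union>P" unfolding partition_onD1[OF P, symmetric] by auto
  then obtain A where A: "A \<in> P" "Inl 0 \<in> A" by blast
  \<comment> \<open>The block of the skeleton has to stay, and blocks without copies of
    \<open>- h\<close> would not change the multiple of \<open>h\<close>.\<close>
  define R where "R = {B \<in> P. Inl 0 \<notin> B \<and> Inr -` B \<noteq> {}}"
  have finR: "finite R" using finP by (simp add: R_def)
  have "{..<x} \<subseteq> Inr -` A \<union> (\<Union>B\<in>R. Inr -` B)"
  proof
    fix j assume "j \<in> {..<x}"
    then have "Inr j \<in> \<Union>P" using partition_onD1[OF P] by auto
    then obtain B where B: "B \<in> P" "Inr j \<in> B" by blast
    show "j \<in> Inr -` A \<union> (\<Union>B\<in>R. Inr -` B)"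
    proof (cases "Inl 0 \<in> B")
      case True
      then have "A = B" using A B(1) partition_onD2[OF P] unfolding disjoint_def by blast
      then show ?thesis using B by blast
    next
      case False
      then show ?thesis using B unfolding R_def by auto
    qed
  qed
  then have "card {..<x} \<le> card (Inr -` A \<union> (\<Union>B\<in>R. Inr -` B))"
    using card_Inr A(1) finR by (intro card_mono) (auto simp: R_def)
  also have "\<dots> \<le> card (Inr -` A) + card (\<Union>B\<in>R. Inr -` B)" by (rule card_Un_le)
  also have "\<dots> \<le> F + (\<Sum>B\<in>R. card (Inr -` B))"
    using card_Inr(1)[OF A(1)] card_UN_le[OF finR] by (rule add_mono)
  also have "(\<Sum>B\<in>R. card (Inr -` B)) \<le> card R * F"
    using card_Inr(1) sum_bounded_above[of R "\<lambda>B. card (Inr -` B)" F] by (auto simp: R_def)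
  finally have "x \<le> (card R + 1) * F" by simp
  then have "(F * period n M D W + 1) * F \<le> (card R + 1) * F"
    using assms(6) unfolding threshold_def F_def[symmetric] by linarith
  then have cardR: "F * period n M D W \<le> card R" using F by simp
  have "(\<lambda>B. card (Inr -` B)) \<in> R \<rightarrow> {1..F}"
    using card_Inr by (auto simp: R_def Suc_le_eq card_gt_0_iff)
  from pigeonhole_card[OF this finR finite_atLeastAtMost]
  have "\<exists>g\<in>{1..F}. card ((\<lambda>B. card (Inr -` B)) -` {g} \<inter> R) * F \<ge> card R" using F by simp
  then obtain g where g: "1 \<le> g" "g \<le> F"
    "card ((\<lambda>B. card (Inr -` B)) -` {g} \<inter> R) * F \<ge> card R" by (metis atLeastAtMost_iff)
  let ?R = "(\<lambda>B. card (Inr -` B)) -` {g} \<inter> R"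
  have "F * period n M D W \<le> F * card ?R" using cardR order_trans[OF _ g(3)] by (simp only: mult.commute)
  then have "period n M D W \<le> card ?R" using F by simp
  then have "period n M D W div g \<le> card ?R" using div_le_dividend order_trans by blast
  then obtain S where S: "S \<subseteq> ?R" "card S = period n M D W div g" "finite S"
    using obtain_subset_with_card_n by metis
  have SP: "S \<subseteq> P" and S0: "Inl 0 \<notin> \<Union>S" using S(1) by (auto simp: R_def)
  have "Inr -` \<Union>S = (\<Union>B\<in>S. Inr -` B)" by (rule vimage_Union)
  also have "card \<dots> = (\<Sum>B\<in>S. card (Inr -` B))"
  proof (rule card_UN_disjoint[OF S(3)]; intro ballI impI)
    fix B assume B: "B \<in> S"
    then show "finite (Inr -` B)" using card_Inr(2) SP by blast
    fix B' assume "B' \<in> S" "B \<noteq> B'"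
    then have "B \<inter> B' = {}" using partition_onD2[OF P] B SP unfolding disjoint_def by blast
    then show "Inr -` B \<inter> Inr -` B' = {}" by blast
  qed
  also have "\<dots> = (\<Sum>B\<in>S. g)" using S(1) by (intro sum.cong) auto
  also have "\<dots> = period n M D W div g * g" using S(2) by simp
  also have "\<dots> = period n M D W" using g unfolding period_def F_def by (simp add: dvd_fact)
  finally have "card (Inr -` \<Union>S) = period n M D W" .
  then show ?thesis using keep[rule_format, OF SP S0] by auto
qed

text \<open>For negative \<open>x\<close> the copies are taken of the negated all-ones direction. As
  the period is at most the threshold, both shifts move the parameter towards 0 and not past
  it.\<close>

lemma walk_shift:
  assumes "walk p es q" "p \<in> Q" "\<And>k. k < D \<Longrightarrow> eff lab es k = w k + x"
    "\<And>k. k < D \<Longrightarrow> \<bar>w k\<bar> \<le> int W"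
  shows "int (threshold n M D W) \<le> x \<Longrightarrow>
      \<exists>es'. walk p es' q \<and> (\<forall>k<D. eff lab es' k = w k + (x - int (period n M D W)))"
    and "x \<le> - int (threshold n M D W) \<Longrightarrow>
      \<exists>es'. walk p es' q \<and> (\<forall>k<D. eff lab es' k = w k + (x + int (period n M D W)))"
proof -
  note le = period_le_threshold[of n M D W]
  show "\<exists>es'. walk p es' q \<and> (\<forall>k<D. eff lab es' k = w k + (x - int (period n M D W)))"
    if x: "int (threshold n M D W) \<le> x"
  proof -
    have "int (nat x - period n M D W) = x - int (period n M D W)" using x le by linarith
    then show ?thesis
      using walk_reduce[OF assms(1,2), of w "nat x" "\<lambda>_. 1" W] assms(3,4) x by simp
  qed
  show "\<exists>es'. walk p es' q \<and> (\<forall>k<D. eff lab es' k = w k + (x + int (period n M D W)))"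
    if x: "x \<le> - int (threshold n M D W)"
  proof -
    have "- int (nat (- x) - period n M D W) = x + int (period n M D W)" using x le by linarith
    moreover have "threshold n M D W \<le> nat (- x)" using x by linarith
    ultimately show ?thesis
      using walk_reduce[OF assms(1,2), of w "nat (- x)" "\<lambda>_. - 1" W] assms(3,4) x by (simp add: add.commute)
  qed
qed

end

section \<open>One-dimensional systems with periodic step sets\<close>

text \<open>Rung 0 dominates the initial value, the zone and every value to which a large upward
  step of a minimal run can lead. The next rung accounts for a step below \<open>B\<close> followed
  by an edge with multiplier at most \<open>A\<close>.\<close>

definition ladder :: "nat \<Rightarrow> nat \<Rightarrow> nat \<Rightarrow> nat \<Rightarrow> nat \<Rightarrow> nat \<Rightarrow> nat" where
  "ladder A b P B X s = ((\<lambda>y. A * (y + B) + b) ^^ s) (X + (2 * B + b) + (A * (2 * B + b + P) + b))"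

text \<open>Multiplying by \<open>m\<close> does not shrink \<open>x + d\<close>, so bounded values
  force bounded steps; only bounded steps can be realised by walks of bounded length.\<close>

lemma affine_step_bound:
  fixes x y m d a :: int
  assumes "y = m * (x + d) + a" "2 \<le> m" "\<bar>y\<bar> \<le> Y" "\<bar>x\<bar> \<le> Y" "\<bar>a\<bar> \<le> b"
  shows "\<bar>d\<bar> \<le> 2 * Y + b"
proof -
  have "1 * \<bar>x + d\<bar> \<le> m * \<bar>x + d\<bar>" using assms(2) by (intro mult_right_mono) auto
  also have "\<dots> = \<bar>m * (x + d)\<bar>" using assms(2) by (simp add: abs_mult)
  also have "m * (x + d) = y - a" using assms(1) by simp
  finally show ?thesis
    using assms(3-5) abs_triangle_ineq4[of y a] abs_triangle_ineq4[of "x + d" x] by simp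
qed

text \<open>An edge adds some \<open>d\<close> from its step set before it multiplies. Periodicity
  is used only in this form: a step beyond the threshold may be moved towards 0 by one
  period.\<close>

locale levels =
  fixes E :: "'e set" and src tgt :: "'e \<Rightarrow> 's" and steps :: "'e \<Rightarrow> int set" and
    mul add :: "'e \<Rightarrow> int" and V :: "'s set" and n A b P B :: nat
  assumes finite_V: "finite V" and card_V: "card V \<le> n" and tgt_V: "t \<in> E \<Longrightarrow> tgt t \<in> V"
    and mul: "t \<in> E \<Longrightarrow> 2 \<le> mul t" "t \<in> E \<Longrightarrow> mul t \<le> int A"
    and add: "t \<in> E \<Longrightarrow> \<bar>add t\<bar> \<le> int b"
    and P_pos: "0 < P" and P_le_B: "P \<le> B"
    and steps_down: "t \<in> E \<Longrightarrow> d \<in> steps t \<Longrightarrow> int B \<le> d \<Longrightarrow> d - int P \<in> steps t"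
    and steps_up: "t \<in> E \<Longrightarrow> d \<in> steps t \<Longrightarrow> d \<le> - int B \<Longrightarrow> d + int P \<in> steps t"
begin

fun run :: "'s \<Rightarrow> int \<Rightarrow> ('e \<times> int) list \<Rightarrow> 's \<Rightarrow> int \<Rightarrow> bool" where
  "run r x [] z y \<longleftrightarrow> r = z \<and> x = y"
| "run r x ((t, d) # ss) z y \<longleftrightarrow>
    t \<in> E \<and> src t = r \<and> d \<in> steps t \<and> run (tgt t) (mul t * (x + d) + add t) ss z y"

text \<open>A tie-breaker among shortest runs, which excludes needlessly large upward steps.\<close>

definition weight :: "('e \<times> int) list \<Rightarrow> nat" where
  "weight ss = (\<Sum>s\<leftarrow>ss. nat \<bar>snd s\<bar>)"

text \<open>Even after a step of \<open>- B\<close> the value is at least \<open>B + b\<close>, and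
  doubling it and subtracting \<open>b\<close> leads back into the zone.\<close>

definition zone :: int where
  "zone = 2 * int B + int b"

lemma run_append: "run r x (ss @ ss') z y \<longleftrightarrow> (\<exists>r' x'. run r x ss r' x' \<and> run r' x' ss' z y)"
proof (induction ss arbitrary: r x)
  case (Cons s ss)
  obtain t d where "s = (t, d)" by force
  then show ?case by (simp add: Cons.IH)
qed simp

lemma zone_step:
  assumes "t \<in> E" "x + d \<ge> zone - int B"
  shows "mul t * (x + d) + add t \<ge> zone"
proof -
  define y where "y = mul t * (x + d)"
  have "2 * (x + d) \<le> y"
    unfolding y_def using mul(1)[OF assms(1)] assms(2) by (intro mult_right_mono) (auto simp: zone_def)
  moreover have "- int b \<le> add t" using add[OF assms(1)] by simp
  ultimately have "zone \<le> y + add t" using assms(2) unfolding zone_def by simp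
  then show ?thesis by (simp add: y_def)
qed

text \<open>The step is raised period by period until it passes \<open>- B\<close> or all
  \<open>m\<close> periods are used up; it stays nonpositive because
  \<open>P \<le> B\<close>.\<close>

lemma absorb:
  assumes "t \<in> E" "d \<in> steps t" "d \<le> - int B"
  shows "\<exists>k\<le>m. d + int P * int k \<in> steps t \<and> d + int P * int k \<le> 0 \<and>
    (k = m \<or> - int B < d + int P * int k)"
proof (induction m)
  case 0
  then show ?case using assms by auto
next
  case (Suc m)
  then obtain k where k: "k \<le> m" "d + int P * int k \<in> steps t" "d + int P * int k \<le> 0"
    "k = m \<or> - int B < d + int P * int k" by blast
  show ?case
  proof (cases "- int B < d + int P * int k")
    case True
    then show ?thesis using k by (intro exI[of _ k]) auto
  next
    case False
    then have "k = m" using k(4) by blast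
    have "d + int P * int k + int P \<in> steps t" using steps_up[OF assms(1) k(2)] False by simp
    moreover have "d + int P * int k + int P \<le> 0" using False P_le_B by simp
    moreover have "d + int P * int k + int P = d + int P * int (Suc m)"
      using \<open>k = m\<close> by (simp add: algebra_simps)
    ultimately show ?thesis by (intro exI[of _ "Suc m"]) auto
  qed
qed

text \<open>The excess \<open>P * m\<close> of the starting value, which later multiplications only enlarge, is absorbed by
  the downward steps \<open>d \<le> - B\<close>, as far as each of them permits. Since the original run ends in 0, all of
  it is absorbed before the value can leave the zone.\<close>

lemma replay:
  assumes "run r (x + int P * int m) ss z 0" "zone \<le> x"
  shows "\<exists>ss'. run r x ss' z 0 \<and> length ss' = length ss \<and> weight ss' \<le> weight ss"
  using assms
proof (induction ss arbitrary: r x m)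
  case Nil
  have "0 \<le> int P * int m" by simp
  moreover have "x + int P * int m = 0" using Nil(1) by simp
  moreover have "0 < x" using Nil(2) P_pos P_le_B unfolding zone_def by linarith
  ultimately show ?case by linarith
next
  case (Cons s ss)
  obtain t d where s: "s = (t, d)" by force
  have t: "t \<in> E" "src t = r" "d \<in> steps t"
    and rest: "run (tgt t) (mul t * (x + int P * int m + d) + add t) ss z 0"
    using Cons.prems(1) by (auto simp: s)
  obtain k where k: "k \<le> m" "d + int P * int k \<in> steps t" "\<bar>d + int P * int k\<bar> \<le> \<bar>d\<bar>"
    "k = m \<or> - int B < d + int P * int k"
  proof (cases "d \<le> - int B")
    case True
    obtain k where k: "k \<le> m" "d + int P * int k \<in> steps t" "d + int P * int k \<le> 0"
      "k = m \<or> - int B < d + int P * int k" using absorb[OF t(1,3) True] by blast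
    moreover have "0 \<le> int P * int k" by simp
    then have "\<bar>d + int P * int k\<bar> \<le> \<bar>d\<bar>" using k(3) by linarith
    ultimately show ?thesis using that by blast
  next
    case False
    then show ?thesis using that[of 0] t(3) by simp
  qed
  define d' where "d' = d + int P * int k"
  define x' where "x' = mul t * (x + d') + add t"
  \<comment> \<open>The multiplication scales the excess not yet absorbed, which remains a
    nonnegative multiple of \<open>P\<close>.\<close>
  have "mul t * (x + int P * int m + d) + add t = x' + int P * int (nat (mul t) * (m - k))"
    using k(1) mul(1)[OF t(1)] by (simp add: x'_def d'_def algebra_simps of_nat_diff)
  then have rest': "run (tgt t) (x' + int P * int (nat (mul t) * (m - k))) ss z 0"
    using rest by simp
  have "\<exists>ss'. run (tgt t) x' ss' z 0 \<and> length ss' = length ss \<and> weight ss' \<le> weight ss"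
  proof (cases "k = m")
    case True
    then show ?thesis using rest' by auto
  next
    case False
    \<comment> \<open>Absorption has stopped early, so the new step lies above \<open>- B\<close>
      and the value cannot leave the zone.\<close>
    then have "zone \<le> x'" using k(4) Cons.prems(2) zone_step[OF t(1), of x d']
      unfolding x'_def d'_def by linarith
    then show ?thesis using Cons.IH rest' by blast
  qed
  then obtain ss' where "run (tgt t) x' ss' z 0" "length ss' = length ss" "weight ss' \<le> weight ss"
    by blast
  then show ?case using t k(2,3)
    by (intro exI[of _ "(t, d') # ss'"]) (auto simp: s x'_def d'_def weight_def)
qed

section \<open>Minimal runs and the upper bound on their values\<close>

definition minimal_run :: "'s \<Rightarrow> int \<Rightarrow> ('e \<times> int) list \<Rightarrow> 's \<Rightarrow> bool" where
  "minimal_run r x ss z \<longleftrightarrow> run r x ss z 0 \<and>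
    (\<forall>ss'. run r x ss' z 0 \<longrightarrow> length ss < length ss' \<or> length ss = length ss' \<and> weight ss \<le> weight ss')"

lemma minimal_run_exists:
  assumes "run r x ss z 0" shows "\<exists>ss. minimal_run r x ss z"
proof -
  obtain s1 where s1: "run r x s1 z 0" "\<And>s. run r x s z 0 \<Longrightarrow> length s1 \<le> length s"
    using ex_has_least_nat[of "\<lambda>s. run r x s z 0" _ length] assms by blast
  obtain s2 where s2: "run r x s2 z 0" "length s2 = length s1"
    "\<And>s. run r x s z 0 \<Longrightarrow> length s = length s1 \<Longrightarrow> weight s2 \<le> weight s"
    using ex_has_least_nat[of "\<lambda>s. run r x s z 0 \<and> length s = length s1" _ weight] s1(1) by blast
  have "minimal_run r x s2 z" unfolding minimal_run_def using s1(2) s2 by (metis nat_less_le)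
  then show ?thesis by blast
qed

text \<open>Edges and step sets are not checked here, so that node and value at a position are total
  functions; along a run they are its configurations.\<close>

fun after :: "'s \<Rightarrow> int \<Rightarrow> ('e \<times> int) list \<Rightarrow> 's \<times> int" where
  "after r x [] = (r, x)"
| "after r x ((t, d) # ss) = after (tgt t) (mul t * (x + d) + add t) ss"

abbreviation node_at where "node_at r x ss i \<equiv> fst (after r x (take i ss))"
abbreviation val_at where "val_at r x ss i \<equiv> snd (after r x (take i ss))"

lemma run_after: "run r x ss z y \<Longrightarrow> after r x ss = (z, y)"
  by (induction ss arbitrary: r x) auto

lemma run_at:
  assumes "run r x ss z y"
  shows "run r x (take i ss) (node_at r x ss i) (val_at r x ss i)"
    "run (node_at r x ss i) (val_at r x ss i) (drop i ss) z y"
proof -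
  have "run r x (take i ss @ drop i ss) z y" using assms by simp
  then obtain r' x' where "run r x (take i ss) r' x'" "run r' x' (drop i ss) z y"
    unfolding run_append by blast
  then show "run r x (take i ss) (node_at r x ss i) (val_at r x ss i)"
    "run (node_at r x ss i) (val_at r x ss i) (drop i ss) z y"
    using run_after by fastforce+
qed

lemma node_at_V: "run r x ss z y \<Longrightarrow> r \<in> V \<Longrightarrow> node_at r x ss i \<in> V"
proof (induction ss arbitrary: r x i)
  case (Cons s ss)
  then show ?case using tgt_V by (cases s; cases i) auto
qed simp

lemma after_append: "after r x (ss @ ss') = case_prod after (after r x ss) ss'"
  by (induction ss arbitrary: r x) auto

lemma val_at_Suc:
  assumes "i < length ss"
  shows "val_at r x ss (Suc i) =
    mul (fst (ss ! i)) * (val_at r x ss i + snd (ss ! i)) + add (fst (ss ! i))"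
  using assms by (cases "ss ! i") (simp add: take_Suc_conv_app_nth after_append split: prod.split)

lemma run_nth:
  assumes "run r x ss z y" "i < length ss"
  shows "fst (ss ! i) \<in> E" "snd (ss ! i) \<in> steps (fst (ss ! i))"
  using assms by (induction ss arbitrary: r x i) (auto simp: nth_Cons split: nat.splits)

text \<open>The part between \<open>i\<close> and \<open>j\<close> is cut out. After equal values
  the rest is reused unchanged; after a value larger by a multiple of \<open>P\<close> it is adapted
  by \<open>replay\<close>. Either way the run gets shorter.\<close>

lemma minimal_run_no_return:
  assumes "minimal_run r x ss z" "i < j" "j \<le> length ss"
    "node_at r x ss i = node_at r x ss j"
  shows "val_at r x ss i \<noteq> val_at r x ss j"
    "zone \<le> val_at r x ss i \<Longrightarrow> val_at r x ss j \<noteq> val_at r x ss i + int P * int m"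
proof -
  have run: "run r x ss z 0" using assms(1) unfolding minimal_run_def by blast
  have short: False if "run (node_at r x ss i) (val_at r x ss i) ss' z 0"
    "length ss' = length (drop j ss)" for ss'
  proof -
    have "run r x (take i ss @ ss') z 0" using run_at(1)[OF run] that(1) run_append by blast
    moreover have "length (take i ss @ ss') < length ss" using that(2) assms(2,3) by simp
    ultimately show False using assms(1) unfolding minimal_run_def by (metis less_asym nat_neq_iff)
  qed
  show "val_at r x ss i \<noteq> val_at r x ss j"
    using short[of "drop j ss"] run_at(2)[OF run, of j] assms(4) by auto
  show "val_at r x ss j \<noteq> val_at r x ss i + int P * int m" if "zone \<le> val_at r x ss i"
  proof
    assume "val_at r x ss j = val_at r x ss i + int P * int m"
    then have "run (node_at r x ss i) (val_at r x ss i + int P * int m) (drop j ss) z 0"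
      using run_at(2)[OF run, of j] assms(4) by simp
    from replay[OF this that] show False using short by blast
  qed
qed

text \<open>Otherwise lowering the step by \<open>P\<close> would still leave the value in the zone
  after multiplication, and \<open>replay\<close> would absorb the difference
  \<open>P * mul t\<close> without extra length or weight, so that the total weight would
  drop.\<close>

lemma minimal_run_big_step:
  assumes "minimal_run r x ss z" "i < length ss" "int B \<le> snd (ss ! i)"
  shows "val_at r x ss i + snd (ss ! i) < zone + int P"
proof (rule ccontr)
  have run: "run r x ss z 0" using assms(1) unfolding minimal_run_def by blast
  obtain t d where td: "ss ! i = (t, d)" by force
  define r' where "r' = node_at r x ss i"
  define x' where "x' = val_at r x ss i"
  assume "\<not> ?thesis"
  then have big: "zone + int P \<le> x' + d" by (simp add: td x'_def)
  have drop: "drop i ss = (t, d) # drop (Suc i) ss" using assms(2) td by (metis Cons_nth_drop_Suc)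
  have t: "t \<in> E" "src t = r'" "d \<in> steps t"
    and rest: "run (tgt t) (mul t * (x' + d) + add t) (drop (Suc i) ss) z 0"
    using run_at(2)[OF run, of i] unfolding drop r'_def[symmetric] x'_def[symmetric] by auto
  define d' where "d' = d - int P"
  have d': "d' \<in> steps t" using steps_down[OF t(1,3)] assms(3) td by (simp add: d'_def)
  have "mul t * (x' + d) + add t = mul t * (x' + d') + add t + int P * int (nat (mul t))"
    using mul(1)[OF t(1)] by (simp add: d'_def algebra_simps)
  moreover have "zone \<le> mul t * (x' + d') + add t"
    using big by (intro zone_step t) (simp add: d'_def)
  ultimately obtain ss' where ss': "run (tgt t) (mul t * (x' + d') + add t) ss' z 0"
    "length ss' = length (drop (Suc i) ss)" "weight ss' \<le> weight (drop (Suc i) ss)"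
    using replay rest by metis
  have "run r x (take i ss @ (t, d') # ss') z 0"
    using run_at(1)[OF run, of i] t d' ss'(1) unfolding r'_def x'_def run_append by auto
  moreover have "length (take i ss @ (t, d') # ss') = length ss" using ss'(2) assms(2) by simp
  ultimately have "weight ss \<le> weight (take i ss @ (t, d') # ss')"
    using assms(1) unfolding minimal_run_def by (metis nat_neq_iff)
  moreover have "weight ss = weight (take i ss @ (t, d) # drop (Suc i) ss)"
    using drop by (metis append_take_drop_id)
  moreover have "nat \<bar>d'\<bar> < nat \<bar>d\<bar>" using assms(3) P_le_B P_pos by (simp add: td d'_def)
  moreover have "weight (u @ (t, c) # u') = weight u + nat \<bar>c\<bar> + weight u'" for u c u'
    by (simp add: weight_def)
  ultimately show False using ss'(3) by simp
qed

lemma ladder_mono: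
  assumes "E \<noteq> {}" "s \<le> s'" shows "ladder A b P B X s \<le> ladder A b P B X s'"
proof -
  obtain t where "t \<in> E" using assms(1) by blast
  then have "1 \<le> A" using mul by fastforce
  then have "1 * (y + B) \<le> A * (y + B)" for y by (rule mult_le_mono1)
  then have "y \<le> A * (y + B) + b" for y by (metis add_leD1 mult_1 trans_le_add1)
  then show ?thesis using lift_Suc_mono_le[of "ladder A b P B X"] assms(2) by (simp add: ladder_def)
qed

text \<open>The values \<open>ladder \<dots> s\<close> bound successive record values: a record beyond \<open>ladder \<dots> s\<close> can only be
  reached by a step \<open>d < B\<close>, so that it does not exceed \<open>ladder \<dots> (Suc s)\<close>.\<close>

lemma minimal_run_val_le:
  assumes "minimal_run r x ss z" "r \<in> V" "\<bar>x\<bar> \<le> int X" "i \<le> length ss"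
  shows "val_at r x ss i \<le> int (ladder A b P B X (n * P))"
proof (rule ccontr)
  let ?T = "\<lambda>s. int (ladder A b P B X s)"
  let ?v = "val_at r x ss"
  let ?K = "n * P"
  have run: "run r x ss z 0" using assms(1) unfolding minimal_run_def by blast
  assume "\<not> ?thesis"
  then have big: "?T ?K < ?v i" by simp
  have T0: "int X + zone + (int A * (zone + int P) + int b) = ?T 0" by (simp add: ladder_def zone_def)
  have zone0: "0 \<le> zone" by (simp add: zone_def)
  then have A0: "0 \<le> int A * (zone + int P)" by simp
  have "0 \<le> ?T ?K" by simp
  have "x \<le> ?T 0" using assms(3) T0 zone0 A0 by linarith
  have "ss \<noteq> []"
  proof
    assume "ss = []"
    then have "x = 0" "?v i = x" using run by auto
    then show False using big by simp
  qed
  then have "E \<noteq> {}" using run_nth(1)[OF run, of 0] by auto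
  note mono = ladder_mono[OF this, of _ _ X]
  \<comment> \<open>The first position above rung \<open>s\<close>. The rungs 0 to
    \<open>n * P\<close> give one record more than there are pairs of a node and a residue modulo
    \<open>P\<close>.\<close>
  define f where "f s = (LEAST j. ?T s < ?v j)" for s
  have f: "?T s < ?v (f s)" "f s \<le> i" "?v (f s) \<le> ?T (Suc s)" if "s \<le> ?K" for s
  proof -
    have ex: "?T s < ?v i" using big mono[OF that] by linarith
    show 1: "?T s < ?v (f s)" unfolding f_def using ex by (rule LeastI)
    show "f s \<le> i" unfolding f_def using ex by (rule Least_le)
    have "x \<le> ?T s" using \<open>x \<le> ?T 0\<close> mono[of 0 s] by linarith
    then have "f s \<noteq> 0" using 1 by (metis after.simps(1) not_le snd_conv take0)
    then obtain j where j: "f s = Suc j" using not0_implies_Suc by blast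
    have "?v j \<le> ?T s" using not_less_Least[of j "\<lambda>j. ?T s < ?v j"] j unfolding f_def by simp
    obtain t d where td: "ss ! j = (t, d)" by force
    have jl: "j < length ss" using \<open>f s \<le> i\<close> j assms(4) by simp
    have t: "t \<in> E" using run_nth(1)[OF run jl] td by simp
    have vS: "?v (f s) = mul t * (?v j + d) + add t" using val_at_Suc[OF jl] td j by simp
    have upper: "mul t * y + add t \<le> int A * y' + int b" if "y \<le> y'" "0 \<le> y'" for y y'
    proof -
      have "mul t * y \<le> mul t * y'" using mul(1)[OF t] that by (intro mult_left_mono) auto
      also have "\<dots> \<le> int A * y'" using mul(2)[OF t] that by (intro mult_right_mono)
      finally show ?thesis using add[OF t] by linarith
    qed
    \<comment> \<open>By minimality a large upward step leaves a value below \<open>zone + P\<close>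
      before multiplication, hence at most rung 0 after it, and cannot set a record.\<close>
    have "d < int B"
    proof (rule ccontr)
      assume "\<not> d < int B"
      then have "?v j + d < zone + int P" using minimal_run_big_step[OF assms(1) jl] td by simp
      then have "?v (f s) \<le> int A * (zone + int P) + int b"
        unfolding vS using zone0 by (intro upper) auto
      also have "\<dots> \<le> ?T 0" using T0 zone0 by simp
      also have "\<dots> \<le> ?T s" using mono[of 0 s] by simp
      finally show False using 1 by simp
    qed
    then have "?v (f s) \<le> int A * (?T s + int B) + int b"
      unfolding vS using \<open>?v j \<le> ?T s\<close> by (intro upper) auto
    then show "?v (f s) \<le> ?T (Suc s)" by (simp add: ladder_def)
  qed
  let ?g = "\<lambda>s. (node_at r x ss (f s), ?v (f s) mod int P)"
  have sub: "?g ` {..?K} \<subseteq> V \<times> {0..<int P}" using node_at_V[OF run assms(2)] P_pos by auto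
  have "card (V \<times> {0..<int P}) \<le> ?K" using card_V by (simp add: card_cartesian_product)
  moreover have "finite (V \<times> {0..<int P})" using finite_V by simp
  ultimately have "card (?g ` {..?K}) \<le> ?K" using card_mono[OF _ sub] by linarith
  then have "\<not> inj_on ?g {..?K}" using card_image[of ?g "{..?K}"] by auto
  then obtain s s' where s: "s < s'" "s' \<le> ?K" "?g s = ?g s'"
    unfolding inj_on_def by (metis atMost_iff linorder_neqE_nat)
  \<comment> \<open>The record for \<open>s\<close> does not pass rung \<open>Suc s\<close>, so the
    later record is strictly larger, as cutting requires.\<close>
  have "?v (f s) < ?v (f s')" using f(3)[of s] f(1)[of s'] mono[of "Suc s" s'] s by simp
  moreover have "f s \<le> f s'" unfolding f_def[of s]
    using f(1)[of s'] mono[of s s'] s by (intro Least_le) simp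
  ultimately have "f s < f s'" using nat_less_le by auto
  have "int P dvd ?v (f s') - ?v (f s)" using s(3) by (metis Pair_inject mod_eq_dvd_iff)
  then obtain k where k: "?v (f s') - ?v (f s) = int P * k" by (elim dvdE)
  then have "0 < int P * k" using \<open>?v (f s) < ?v (f s')\<close> by simp
  then have "0 \<le> k" using P_pos by (simp add: zero_less_mult_iff)
  then have "?v (f s') = ?v (f s) + int P * int (nat k)" using k by simp
  moreover have "zone \<le> ?v (f s)" using f(1)[of s] s mono[of 0 s] T0 A0 by simp
  ultimately show False
    using minimal_run_no_return(2)[OF assms(1) \<open>f s < f s'\<close>, of "nat k"] f(2)[of s'] s assms(4) by auto
qed

end

text \<open>Negating values, steps and additive terms exchanges \<open>steps_up\<close> and
  \<open>steps_down\<close> and keeps the multipliers.\<close>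

lemma (in levels) levels_neg: "levels E tgt (\<lambda>t. uminus ` steps t) mul (\<lambda>t. - add t) V n A b P B"
proof
  fix t d assume t: "t \<in> E" and d: "d \<in> uminus ` steps t"
  from d have "- d \<in> steps t" by auto
  show "d - int P \<in> uminus ` steps t" if "int B \<le> d"
    using steps_up[OF t \<open>- d \<in> steps t\<close>] that by (intro image_eqI[of _ _ "- d + int P"]) auto
  show "d + int P \<in> uminus ` steps t" if "d \<le> - int B"
    using steps_down[OF t \<open>- d \<in> steps t\<close>] that by (intro image_eqI[of _ _ "- d - int P"]) auto
qed (simp_all only: finite_V card_V tgt_V mul add P_pos P_le_B abs_minus)

context levels
begin

interpretation neg: levels E src tgt "\<lambda>t. uminus ` steps t" mul "\<lambda>t. - add t" V n A b P B
  by (rule levels_neg)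

abbreviation flip :: "('e \<times> int) list \<Rightarrow> ('e \<times> int) list" where
  "flip \<equiv> map (apsnd uminus)"

lemma flip_flip: "flip (flip ss) = ss"
  by (induction ss) auto

lemma neg_run: "neg.run r (- x) (flip ss) z (- y) \<longleftrightarrow> run r x ss z y"
proof (induction ss arbitrary: r x)
  case (Cons s ss)
  obtain t d where s: "s = (t, d)" by force
  have "mul t * (- x + - d) + - add t = - (mul t * (x + d) + add t)" by (simp add: algebra_simps)
  then show ?case using Cons.IH[of "tgt t" "mul t * (x + d) + add t"] by (simp add: s image_iff)
qed auto

lemma neg_after: "neg.after r (- x) (flip ss) = apsnd uminus (after r x ss)"
proof (induction ss arbitrary: r x)
  case (Cons s ss)
  obtain t d where s: "s = (t, d)" by force
  have "mul t * (- x + - d) + - add t = - (mul t * (x + d) + add t)" by (simp add: algebra_simps)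
  then show ?case using Cons.IH[of "tgt t" "mul t * (x + d) + add t"] by (simp add: s)
qed auto

lemma weight_flip: "weight (flip ss) = weight ss"
  by (simp add: weight_def comp_def)

lemma neg_minimal_run:
  assumes "minimal_run r x ss z" shows "neg.minimal_run r (- x) (flip ss) z"
proof -
  have "length ss < length ss' \<or> length ss = length ss' \<and> weight ss \<le> weight ss'"
    if "neg.run r (- x) ss' z 0" for ss'
  proof -
    have "run r x (flip ss') z 0" using that neg_run[of r x "flip ss'" z 0] by (simp only: flip_flip minus_zero)
    then show ?thesis using assms unfolding minimal_run_def by (metis length_map weight_flip)
  qed
  moreover have "neg.run r (- x) (flip ss) z 0"
    using assms neg_run[of r x ss z 0] by (simp add: minimal_run_def)
  ultimately show ?thesis by (simp add: neg.minimal_run_def weight_flip)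
qed

text \<open>The upper bound for a minimal run and for its mirror image confines all values to
  \<open>- Y\<close> up to \<open>Y\<close>. As no pair of node and value repeats, the number of
  such pairs bounds the length.\<close>

theorem bounded_run:
  assumes "run r x ss z 0" "r \<in> V" "\<bar>x\<bar> \<le> int X"
  defines "Y \<equiv> ladder A b P B X (n * P)"
  obtains ss' where "run r x ss' z 0" "length ss' \<le> n * (2 * Y + 1)"
    "\<forall>s\<in>set ss'. \<bar>snd s\<bar> \<le> int (2 * Y + b)"
proof -
  obtain ss where min: "minimal_run r x ss z" using minimal_run_exists[OF assms(1)] by blast
  then have run: "run r x ss z 0" by (simp add: minimal_run_def)
  let ?v = "val_at r x ss"
  have bound: "\<bar>?v i\<bar> \<le> int Y" if "i \<le> length ss" for i
  proof -
    have "?v i \<le> int Y" using minimal_run_val_le[OF min assms(2,3) that] by (simp add: Y_def)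
    moreover have "- ?v i \<le> int Y"
      using neg.minimal_run_val_le[OF neg_minimal_run[OF min] assms(2), of X i] assms(3) that
      by (simp add: Y_def take_map neg_after)
    ultimately show ?thesis by linarith
  qed
  let ?c = "\<lambda>i. (node_at r x ss i, ?v i)"
  have sub: "?c ` {..length ss} \<subseteq> V \<times> {- int Y..int Y}"
  proof (rule image_subsetI)
    fix i assume "i \<in> {..length ss}"
    then have "?v i \<in> {- int Y..int Y}" using bound[of i] by (simp add: abs_le_iff)
    then show "?c i \<in> V \<times> {- int Y..int Y}" using node_at_V[OF run assms(2)] by blast
  qed
  have "inj_on ?c {..length ss}"
  proof (rule linorder_inj_onI)
    fix i j assume "i < j" "i \<in> {..length ss}" "j \<in> {..length ss}"
    then show "?c i \<noteq> ?c j" using minimal_run_no_return(1)[OF min, of i j] by force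
  qed auto
  then have "card {..length ss} = card (?c ` {..length ss})" by (rule card_image[symmetric])
  also have "\<dots> \<le> card (V \<times> {- int Y..int Y})" using finite_V sub by (intro card_mono) auto
  also have "\<dots> = card V * (2 * Y + 1)"
  proof -
    have "card {- int Y..int Y} = 2 * Y + 1" by simp
    then show ?thesis unfolding card_cartesian_product by simp
  qed
  also have "\<dots> \<le> n * (2 * Y + 1)" using card_V by (rule mult_le_mono1)
  finally have len: "length ss \<le> n * (2 * Y + 1)" by simp
  have "\<bar>snd s\<bar> \<le> int (2 * Y + b)" if s: "s \<in> set ss" for s
  proof -
    obtain i where i: "i < length ss" "ss ! i = s" using s unfolding in_set_conv_nth by blast
    have t: "fst s \<in> E" using run_nth(1)[OF run i(1)] i(2) by simp
    have v: "?v (Suc i) = mul (fst s) * (?v i + snd s) + add (fst s)"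
      unfolding i(2)[symmetric] by (rule val_at_Suc[OF i(1)])
    have "\<bar>?v (Suc i)\<bar> \<le> int Y" "\<bar>?v i\<bar> \<le> int Y" using i(1) by (auto intro!: bound)
    from affine_step_bound[OF v mul(1)[OF t] this add[OF t]]
    show ?thesis by simp
  qed
  then have "\<forall>s\<in>set ss. \<bar>snd s\<bar> \<le> int (2 * Y + b)" ..
  then show thesis by (rule that[OF run len])
qed

end

section \<open>Systems with matrices of ones\<close>

text \<open>For one segment: \<open>d * M\<close> bounds the labels, \<open>2 * d * M\<close> the
  fixed part of the effect and \<open>X\<close> its free parameter.\<close>

definition walk_bound :: "nat \<Rightarrow> nat \<Rightarrow> nat \<Rightarrow> nat \<Rightarrow> nat" where
  "walk_bound d n M X = n * (n + 2) + block_bound (item_bound n (d * M) (2 * d * M + X)) d * n"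

text \<open>\<open>d * M + 2\<close> bounds the multipliers \<open>d * coef t\<close> and 2, and the
  last \<open>d * M\<close> in the first argument group bounds the initial entry sum. The
  \<open>2 * n + 1\<close> nodes are states, multiplying transitions and
  \<open>Final\<close>.\<close>

definition value_bound :: "nat \<Rightarrow> nat \<Rightarrow> nat \<Rightarrow> nat" where
  "value_bound d n M = ladder (d * M + 2) (d * M) (period n (d * M) d (2 * d * M))
    (threshold n (d * M) d (2 * d * M)) (d * M) ((2 * n + 1) * period n (d * M) d (2 * d * M))"

text \<open>The first summand covers runs without multiplication. In the second, every step of the
  one-dimensional run costs a short walk and at most one further transition.\<close>

definition run_bound :: "nat \<Rightarrow> nat \<Rightarrow> nat \<Rightarrow> nat" where
  "run_bound d n M = walk_bound d n M 0 +
    (2 * n + 1) * (2 * value_bound d n M + 1) * (walk_bound d n M (2 * value_bound d n M + d * M) + 1)"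

text \<open>Node \<open>St r\<close> carries the sum of the entries of the current vector. An edge \<open>Jump r t\<close> stands for a walk
  without multiplications from \<open>r\<close> followed by the multiplying transition \<open>t\<close>, and \<open>Last r t\<close> does the
  same for the last such transition of the run; the value at \<open>Fin t\<close> is \<open>d\<close> times the common entry
  of the multiplied vector. The final walk has to reach the target in all coordinates.\<close>

datatype ('s, 't) node = St 's | Fin 't | Final

datatype ('s, 't) edge = Jump 's 't | Last 's 't | End 't

locale ones_system =
  fixes T :: "'t set" and src tgt :: "'t \<Rightarrow> 's" and coef :: "'t \<Rightarrow> nat" and off :: "'t \<Rightarrow> nat \<Rightarrow> int"
    and d :: nat and Q :: "'s set" and n M :: nat
  assumes finite_Q: "finite Q" and card_Q: "card Q \<le> n" and finite_T: "finite T" and card_T: "card T \<le> n"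
    and src_Q: "t \<in> T \<Longrightarrow> src t \<in> Q" and tgt_Q: "t \<in> T \<Longrightarrow> tgt t \<in> Q" and dim_pos: "1 \<le> d"
    and coef_dim: "t \<in> T \<Longrightarrow> 0 < coef t \<Longrightarrow> 2 \<le> d" and coef_le: "t \<in> T \<Longrightarrow> coef t \<le> M"
    and off_le: "t \<in> T \<Longrightarrow> k < d \<Longrightarrow> \<bar>off t k\<bar> \<le> int M"
begin

definition total :: "(nat \<Rightarrow> int) \<Rightarrow> int" where
  "total x = (\<Sum>j<d. x j)"

definition app :: "'t \<Rightarrow> (nat \<Rightarrow> int) \<Rightarrow> nat \<Rightarrow> int" where
  "app t x = (\<lambda>k. (if coef t = 0 then x k else int (coef t) * total x) + off t k)"

fun exec :: "'t list \<Rightarrow> (nat \<Rightarrow> int) \<Rightarrow> nat \<Rightarrow> int" where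
  "exec [] x = x"
| "exec (t # ts) x = exec ts (app t x)"

text \<open>Repeating the sum in all coordinates and scaling the offsets by \<open>d\<close> gives
  both labellings dimension \<open>d\<close> and bound \<open>d * M\<close>, hence a common period
  and threshold.\<close>

abbreviation "lab1 \<equiv> \<lambda>t (k::nat). total (off t)"
abbreviation "lab2 \<equiv> \<lambda>t k. int d * off t k"

lemma total_bound: "(\<And>k. k < d \<Longrightarrow> \<bar>x k\<bar> \<le> int m) \<Longrightarrow> \<bar>total x\<bar> \<le> int (d * m)"
proof -
  assume *: "\<And>k. k < d \<Longrightarrow> \<bar>x k\<bar> \<le> int m"
  have "\<bar>total x\<bar> \<le> (\<Sum>j<d. \<bar>x j\<bar>)" unfolding total_def by (rule sum_abs)
  also have "\<dots> \<le> of_nat (card {..<d}) * int m" using * by (intro sum_bounded_above) auto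
  finally show ?thesis by simp
qed

sublocale full: walks T src tgt Q n
  using finite_Q card_Q src_Q tgt_Q by unfold_locales

sublocale pure1: labelled_walks "{t \<in> T. coef t = 0}" src tgt Q n lab1 d "d * M"
  using finite_Q card_Q src_Q tgt_Q total_bound[OF off_le] by unfold_locales auto

sublocale pure2: labelled_walks "{t \<in> T. coef t = 0}" src tgt Q n lab2 d "d * M"
proof unfold_locales
  fix t k assume "t \<in> {t \<in> T. coef t = 0}" "k < d"
  then have "int d * \<bar>off t k\<bar> \<le> int d * int M" using off_le by (intro mult_left_mono) auto
  then show "\<bar>int d * off t k\<bar> \<le> int (d * M)" by (simp add: abs_mult)
qed

abbreviation "pure_walk \<equiv> pure1.walk"

lemma pure_walk_imp_walk: "pure_walk p ts q \<Longrightarrow> full.walk p ts q"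
  by (induction ts arbitrary: p) auto

lemma walk_imp_pure_walk: "full.walk p ts q \<Longrightarrow> \<forall>t\<in>set ts. coef t = 0 \<Longrightarrow> pure_walk p ts q"
  by (induction ts arbitrary: p) auto

lemma exec_append: "exec (ts @ ts') x = exec ts' (exec ts x)"
  by (induction ts arbitrary: x) auto

lemma exec_pure: "pure_walk p ts q \<Longrightarrow> exec ts x k = x k + eff off ts k"
  by (induction ts arbitrary: p x) (auto simp: app_def eff_def)

lemma eff_lab2: "eff lab2 ts k = int d * eff off ts k"
  by (induction ts) (auto simp: eff_def algebra_simps)

lemma total_exec_pure: "pure_walk p ts q \<Longrightarrow> total (exec ts x) = total x + eff lab1 ts k"
proof (induction ts arbitrary: p x)
  case (Cons t ts)
  then have "total (app t x) = total x + total (off t)" by (simp add: total_def app_def sum.distrib)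
  then show ?case using Cons by (auto simp: eff_def)
qed (simp add: eff_def)

lemma total_app: "0 < coef t \<Longrightarrow> total (app t x) = int (d * coef t) * total x + total (off t)"
  by (simp add: total_def app_def sum.distrib algebra_simps)

end

section \<open>Translation between walks to a fixed target and one-dimensional runs\<close>

locale ones_target = ones_system T src tgt coef off d Q n M
  for T :: "'t set" and src tgt :: "'t \<Rightarrow> 's" and coef off d Q n M +
  fixes q :: 's and v :: "nat \<Rightarrow> int"
  assumes v_le: "k < d \<Longrightarrow> \<bar>v k\<bar> \<le> int M"
begin

definition jumps :: "'t set" where
  "jumps = {t \<in> T. 0 < coef t}"

definition lev_edges :: "('s, 't) edge set" where
  "lev_edges = (\<Union>r\<in>Q. \<Union>t\<in>jumps. {Jump r t, Last r t}) \<union> End ` jumps"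

fun lev_src :: "('s, 't) edge \<Rightarrow> ('s, 't) node" where
  "lev_src (Jump r t) = St r"
| "lev_src (Last r t) = St r"
| "lev_src (End t) = Fin t"

fun lev_tgt :: "('s, 't) edge \<Rightarrow> ('s, 't) node" where
  "lev_tgt (Jump r t) = St (tgt t)"
| "lev_tgt (Last r t) = Fin t"
| "lev_tgt (End t) = Final"

text \<open>The factor 2 of \<open>End\<close> is there because multipliers have to be at least 2;
  doubling does not affect whether the final value is 0.\<close>

fun lev_mul :: "('s, 't) edge \<Rightarrow> int" where
  "lev_mul (Jump r t) = int (d * coef t)"
| "lev_mul (Last r t) = int (d * coef t)"
| "lev_mul (End t) = 2"

fun lev_add :: "('s, 't) edge \<Rightarrow> int" where
  "lev_add (Jump r t) = total (off t)"
| "lev_add (Last r t) = 0"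
| "lev_add (End t) = 0"

definition sum_steps :: "'s \<Rightarrow> 't \<Rightarrow> int set" where
  "sum_steps r t = {e. \<exists>ts. pure_walk r ts (src t) \<and> (\<forall>k<d. eff lab1 ts k = 0 + e)}"

text \<open>If \<open>t\<close> is applied to a vector with entry sum \<open>s\<close>, coordinate
  \<open>k\<close> becomes \<open>coef t * s + off t k\<close>. Scaled by \<open>d\<close>, the
  effect still missing is \<open>d * (v k - off t k)\<close> minus the value
  \<open>d * coef t * s\<close> at \<open>Fin t\<close>, so \<open>e\<close> must cancel that
  value.\<close>

definition end_steps :: "'t \<Rightarrow> int set" where
  "end_steps t = {e. \<exists>ts. pure_walk (tgt t) ts q \<and> (\<forall>k<d. eff lab2 ts k = int d * (v k - off t k) + e)}"

fun lev_steps :: "('s, 't) edge \<Rightarrow> int set" where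
  "lev_steps (Jump r t) = sum_steps r t"
| "lev_steps (Last r t) = sum_steps r t"
| "lev_steps (End t) = end_steps t"

definition lev_nodes :: "('s, 't) node set" where
  "lev_nodes = insert Final (St ` Q \<union> Fin ` jumps)"

lemma target_diff_le:
  assumes "t \<in> T" "k < d" shows "\<bar>int d * (v k - off t k)\<bar> \<le> int (2 * d * M)"
proof -
  have "\<bar>v k - off t k\<bar> \<le> 2 * int M" using v_le[OF assms(2)] off_le[OF assms] by linarith
  then have "int d * \<bar>v k - off t k\<bar> \<le> int d * (2 * int M)" by (intro mult_left_mono) auto
  then show ?thesis unfolding abs_mult by (simp add: ac_simps)
qed

lemma lev_steps_shift:
  assumes "a \<in> lev_edges" "e \<in> lev_steps a"
  shows "int (threshold n (d * M) d (2 * d * M)) \<le> e \<Longrightarrow> e - int (period n (d * M) d (2 * d * M)) \<in> lev_steps a"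
    and "e \<le> - int (threshold n (d * M) d (2 * d * M)) \<Longrightarrow> e + int (period n (d * M) d (2 * d * M)) \<in> lev_steps a"
proof -
  have sum_shift: "(int (threshold n (d * M) d (2 * d * M)) \<le> e \<longrightarrow> e - int (period n (d * M) d (2 * d * M)) \<in> sum_steps r t) \<and>
     (e \<le> - int (threshold n (d * M) d (2 * d * M)) \<longrightarrow> e + int (period n (d * M) d (2 * d * M)) \<in> sum_steps r t)"
    if e: "e \<in> sum_steps r t" and r: "r \<in> Q" for r t
  proof -
    obtain ts where ts: "pure_walk r ts (src t)" "\<And>k. k < d \<Longrightarrow> eff lab1 ts k = 0 + e"
      using e unfolding sum_steps_def by blast
    show ?thesis
      using pure1.walk_shift[OF ts(1) r ts(2), of "2 * d * M"] unfolding sum_steps_def by simp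
  qed
  have end_shift: "(int (threshold n (d * M) d (2 * d * M)) \<le> e \<longrightarrow> e - int (period n (d * M) d (2 * d * M)) \<in> end_steps t) \<and>
     (e \<le> - int (threshold n (d * M) d (2 * d * M)) \<longrightarrow> e + int (period n (d * M) d (2 * d * M)) \<in> end_steps t)"
    if e: "e \<in> end_steps t" and t: "t \<in> T" for t
  proof -
    obtain ts where ts: "pure_walk (tgt t) ts q" "\<And>k. k < d \<Longrightarrow> eff lab2 ts k = int d * (v k - off t k) + e"
      using e unfolding end_steps_def by blast
    show ?thesis
      using pure2.walk_shift[OF ts(1) tgt_Q[OF t] ts(2) target_diff_le[OF t]] unfolding end_steps_def by blast
  qed
  show "e - int (period n (d * M) d (2 * d * M)) \<in> lev_steps a" if "int (threshold n (d * M) d (2 * d * M)) \<le> e"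
    using assms sum_shift end_shift that by (cases a) (auto simp: lev_edges_def jumps_def)
  show "e + int (period n (d * M) d (2 * d * M)) \<in> lev_steps a" if "e \<le> - int (threshold n (d * M) d (2 * d * M))"
    using assms sum_shift end_shift that by (cases a) (auto simp: lev_edges_def jumps_def)
qed

sublocale lev: levels lev_edges lev_src lev_tgt lev_steps lev_mul lev_add lev_nodes "2 * n + 1"
  "d * M + 2" "d * M" "period n (d * M) d (2 * d * M)" "threshold n (d * M) d (2 * d * M)"
proof
  let ?S = "St ` Q :: ('s, 't) node set" and ?F = "Fin ` jumps :: ('s, 't) node set"
  have fin: "finite jumps" using finite_T by (simp add: jumps_def)
  show "finite lev_nodes" using fin finite_Q by (simp add: lev_nodes_def)
  have "card jumps \<le> n" using card_mono[OF finite_T, of jumps] card_T by (auto simp: jumps_def)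
  moreover have "card (?S \<union> ?F) \<le> card ?S + card ?F" by (rule card_Un_le)
  moreover have "card ?S \<le> card Q" "card ?F \<le> card jumps"
    using finite_Q fin by (simp_all add: card_image_le)
  ultimately have "card (?S \<union> ?F) \<le> 2 * n" using card_Q by linarith
  then show "card lev_nodes \<le> 2 * n + 1"
    unfolding lev_nodes_def by (intro order_trans[OF card_insert_le_m1]) auto
  have coef: "2 \<le> int (d * coef t)" "int (d * coef t) \<le> int (d * M + 2)" if "t \<in> jumps" for t
  proof -
    have t: "t \<in> T" "1 \<le> coef t" using that by (auto simp: jumps_def)
    have "2 * 1 \<le> d * coef t" using coef_dim[OF t(1)] t(2) by (intro mult_le_mono) auto
    then show "2 \<le> int (d * coef t)" by linarith
    have "d * coef t \<le> d * M" using coef_le[OF t(1)] by (rule mult_le_mono2)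
    then show "int (d * coef t) \<le> int (d * M + 2)" by linarith
  qed
  show "lev_tgt a \<in> lev_nodes" if "a \<in> lev_edges" for a
    using that tgt_Q by (cases a) (auto simp: lev_edges_def lev_nodes_def jumps_def)
  show "2 \<le> lev_mul a" if "a \<in> lev_edges" for a
    using that coef(1) by (cases a) (auto simp: lev_edges_def)
  show "lev_mul a \<le> int (d * M + 2)" if "a \<in> lev_edges" for a
    using that coef(2) by (cases a) (auto simp: lev_edges_def)
  show "\<bar>lev_add a\<bar> \<le> int (d * M)" if "a \<in> lev_edges" for a
    using that total_bound[OF off_le] by (cases a) (auto simp: lev_edges_def jumps_def)
qed (auto simp: period_pos period_le_threshold lev_steps_shift)

text \<open>The walk is cut at its first multiplying transition. It becomes a \<open>Jump\<close> if
  another one follows, and otherwise \<open>Last\<close> followed by \<open>End\<close>.\<close>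

lemma lev_run_exists:
  assumes "full.walk p ts q" "p \<in> Q" "\<forall>k<d. exec ts u k = v k" "\<exists>t\<in>set ts. 0 < coef t"
  shows "\<exists>ss. lev.run (St p) (total u) ss Final 0"
  using assms
proof (induction "length ts" arbitrary: p ts u rule: less_induct)
  case less
  obtain a t b where ts: "ts = a @ t # b" "0 < coef t" "\<forall>y\<in>set a. coef y = 0"
    using split_list_first_prop[OF less.prems(4)] by auto
  have w: "full.walk p a (src t)" "t \<in> T" "full.walk (tgt t) b q"
    using less.prems(1) ts(1) by (auto simp: full.walk_append)
  have pa: "pure_walk p a (src t)" using walk_imp_pure_walk[OF w(1) ts(3)] .
  define x where "x = exec a u"
  define e where "e = eff lab1 a 0"
  have x: "total x = total u + e" unfolding x_def e_def by (rule total_exec_pure[OF pa])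
  have e: "e \<in> sum_steps p t" using pa by (auto simp: sum_steps_def e_def eff_def)
  have t: "t \<in> jumps" using w(2) ts(2) by (simp add: jumps_def)
  then have edges: "Jump p t \<in> lev_edges" "Last p t \<in> lev_edges" "End t \<in> lev_edges"
    using less.prems(2) by (auto simp: lev_edges_def)
  have ex: "\<forall>k<d. exec b (app t x) k = v k" using less.prems(3) by (simp add: ts(1) exec_append x_def)
  show ?case
  proof (cases "\<exists>t\<in>set b. 0 < coef t")
    case True
    then obtain ss where "lev.run (St (tgt t)) (total (app t x)) ss Final 0"
      using less.hyps[OF _ w(3) tgt_Q[OF w(2)] ex] ts(1) by auto
    then have "lev.run (St p) (total u) ((Jump p t, e) # ss) Final 0"
      using edges e by (simp add: total_app[OF ts(2)] x)
    then show ?thesis by blast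
  next
    case False
    then have pb: "pure_walk (tgt t) b q" using walk_imp_pure_walk[OF w(3)] by auto
    define e' where "e' = - (int (d * coef t) * total x)"
    have "eff lab2 b k = int d * (v k - off t k) + e'" if "k < d" for k
    proof -
      have "v k = int (coef t) * total x + off t k + eff off b k"
        using ex that ts(2) by (simp add: exec_pure[OF pb] app_def)
      then show ?thesis by (simp add: eff_lab2 e'_def algebra_simps)
    qed
    then have "e' \<in> end_steps t" using pb unfolding end_steps_def by blast
    then have "lev.run (St p) (total u) [(Last p t, e), (End t, e')] Final 0"
      using edges e by (simp add: x[symmetric] e'_def)
    then show ?thesis by blast
  qed
qed

lemma sum_steps_short:
  assumes "e \<in> sum_steps r t" "r \<in> Q" "\<bar>e\<bar> \<le> int X"
  shows "\<exists>ts. pure_walk r ts (src t) \<and> length ts \<le> walk_bound d n M X \<and>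
    (\<forall>x. total (exec ts x) = total x + e)"
proof -
  obtain ts where ts: "pure_walk r ts (src t)" "\<And>k. k < d \<Longrightarrow> eff lab1 ts k = e"
    using assms(1) unfolding sum_steps_def by auto
  have "\<bar>eff lab1 ts k\<bar> \<le> int (2 * d * M + X)" if "k < d" for k
    using ts(2)[OF that] order_trans[OF assms(3), of "int (2 * d * M + X)"] by simp
  from pure1.short_walk[OF ts(1) assms(2) this] obtain ts' where ts': "pure_walk r ts' (src t)"
    "length ts' \<le> walk_bound d n M X" "\<forall>k<d. eff lab1 ts' k = eff lab1 ts k"
    unfolding walk_bound_def by blast
  \<comment> \<open>The label does not depend on the coordinate, and coordinate 0 exists because
    \<open>1 \<le> d\<close>.\<close>
  then show ?thesis using ts(2) total_exec_pure[OF ts'(1), of _ 0] dim_pos by auto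
qed

lemma end_steps_short:
  assumes "e \<in> end_steps t" "t \<in> T" "\<bar>e\<bar> \<le> int X"
  shows "\<exists>ts. pure_walk (tgt t) ts q \<and> length ts \<le> walk_bound d n M X \<and>
    (\<forall>k<d. eff lab2 ts k = int d * (v k - off t k) + e)"
proof -
  obtain ts where ts: "pure_walk (tgt t) ts q" "\<And>k. k < d \<Longrightarrow> eff lab2 ts k = int d * (v k - off t k) + e"
    using assms(1) unfolding end_steps_def by auto
  have "\<bar>eff lab2 ts k\<bar> \<le> int (2 * d * M + X)" if "k < d" for k
    using ts(2)[OF that] assms(3) target_diff_le[OF assms(2) that] by simp
  from pure2.short_walk[OF ts(1) tgt_Q[OF assms(2)] this] show ?thesis
    using ts(2) unfolding walk_bound_def by force
qed

text \<open>At a state node only the entry sum has to agree with the value, so each segment may be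
  replaced by any short walk with the same parameter.\<close>

lemma lev_run_realize:
  assumes "lev.run (St r) x ss Final 0" "r \<in> Q" "total u = x" "\<forall>s\<in>set ss. \<bar>snd s\<bar> \<le> int X"
  shows "\<exists>ts. full.walk r ts q \<and> length ts \<le> length ss * (walk_bound d n M X + 1) \<and>
    (\<forall>k<d. exec ts u k = v k)"
  using assms
proof (induction ss arbitrary: r x u)
  case (Cons s ss)
  obtain a e where s: "s = (a, e)" by force
  have a: "a \<in> lev_edges" "lev_src a = St r" "e \<in> lev_steps a" "\<bar>e\<bar> \<le> int X"
    and rest: "lev.run (lev_tgt a) (lev_mul a * (x + e) + lev_add a) ss Final 0"
    using Cons.prems(1,4) by (auto simp: s)
  then consider t where "a = Jump r t" | t where "a = Last r t" by (cases a) auto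
  then show ?case
  proof cases
    case 1
    then have t: "t \<in> T" "0 < coef t" using a(1) by (auto simp: lev_edges_def jumps_def)
    obtain ts where ts: "pure_walk r ts (src t)" "length ts \<le> walk_bound d n M X"
      "\<forall>x. total (exec ts x) = total x + e"
      using sum_steps_short[OF _ Cons.prems(2) a(4)] a(3) 1 by auto
    have tot: "total (app t (exec ts u)) = lev_mul a * (x + e) + lev_add a"
      using ts(3) Cons.prems(3) by (simp add: total_app[OF t(2)] 1)
    have "lev.run (St (tgt t)) (lev_mul a * (x + e) + lev_add a) ss Final 0" using rest 1 by simp
    from Cons.IH[OF this tgt_Q[OF t(1)] tot] Cons.prems(4) obtain ts' where ts': "full.walk (tgt t) ts' q"
      "length ts' \<le> length ss * (walk_bound d n M X + 1)"
      "\<forall>k<d. exec ts' (app t (exec ts u)) k = v k"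
      by auto
    have "full.walk r (ts @ t # ts') q"
      using pure_walk_imp_walk[OF ts(1)] t(1) ts'(1) by (auto simp: full.walk_append)
    then show ?thesis using ts(2) ts'(2,3) by (intro exI[of _ "ts @ t # ts'"]) (simp add: exec_append)
  next
    case 2
    then have t: "t \<in> T" "0 < coef t" using a(1) by (auto simp: lev_edges_def jumps_def)
    obtain ts where ts: "pure_walk r ts (src t)" "length ts \<le> walk_bound d n M X"
      "\<forall>x. total (exec ts x) = total x + e"
      using sum_steps_short[OF _ Cons.prems(2) a(4)] a(3) 2 by auto
    \<comment> \<open>\<open>Fin t\<close> has only the edge \<open>End t\<close>, and
      \<open>Final\<close> has none, so exactly one more step follows.\<close>
    obtain s' ss' where ss: "ss = s' # ss'" using rest 2 by (cases ss) auto
    obtain a' e' where s': "s' = (a', e')" by force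
    have a': "lev_src a' = Fin t" "e' \<in> lev_steps a'" "\<bar>e'\<bar> \<le> int X"
      "lev.run (lev_tgt a') (lev_mul a' * (int (d * coef t) * (x + e) + e') + lev_add a') ss' Final 0"
      using rest 2 Cons.prems(4) by (auto simp: ss s')
    then have a't: "a' = End t" by (cases a') auto
    have "ss' = []"
    proof (cases ss')
      case (Cons s'' l)
      then show ?thesis using a'(4) a't by (cases s''; cases "fst s''") auto
    qed
    then have e': "int (d * coef t) * (x + e) + e' = 0" using a'(4) a't by simp
    obtain ts' where ts': "pure_walk (tgt t) ts' q" "length ts' \<le> walk_bound d n M X"
      "\<forall>k<d. eff lab2 ts' k = int d * (v k - off t k) + e'"
      using end_steps_short[OF _ t(1) a'(3)] a'(2) a't by auto
    have "exec ts' (app t (exec ts u)) k = v k" if "k < d" for k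
    proof -
      have "int d * (v k - off t k - int (coef t) * (x + e)) = int d * eff off ts' k"
      proof -
        have "int d * eff off ts' k = int d * (v k - off t k) + e'" using ts'(3) that by (simp add: eff_lab2)
        moreover have "e' = - (int d * (int (coef t) * (x + e)))" using e' by (simp add: algebra_simps)
        ultimately show ?thesis by (simp add: algebra_simps)
      qed
      then have "v k - off t k - int (coef t) * (x + e) = eff off ts' k" using dim_pos by simp
      then show ?thesis using ts(3) Cons.prems(3) t(2) by (simp add: exec_pure[OF ts'(1)] app_def)
    qed
    moreover have "full.walk r (ts @ t # ts') q"
      using pure_walk_imp_walk[OF ts(1)] t(1) pure_walk_imp_walk[OF ts'(1)]
      by (auto simp: full.walk_append)
    ultimately show ?thesis using ts(2) ts'(2)
      by (intro exI[of _ "ts @ t # ts'"]) (simp add: exec_append ss)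
  qed
qed simp

theorem short_run:
  assumes "full.walk p ts q" "p \<in> Q" "\<forall>k<d. exec ts u k = v k" "\<And>k. k < d \<Longrightarrow> \<bar>u k\<bar> \<le> int M"
  shows "\<exists>ts'. full.walk p ts' q \<and> (\<forall>k<d. exec ts' u k = v k) \<and> length ts' \<le> run_bound d n M"
proof (cases "\<exists>t\<in>set ts. 0 < coef t")
  case True
  obtain ss where ss: "lev.run (St p) (total u) ss Final 0"
    using lev_run_exists[OF assms(1-3) True] by blast
  have "St p \<in> lev_nodes" using assms(2) by (simp add: lev_nodes_def)
  from lev.bounded_run[OF ss this total_bound[OF assms(4)]]
  obtain ss' where ss': "lev.run (St p) (total u) ss' Final 0"
    "length ss' \<le> (2 * n + 1) * (2 * value_bound d n M + 1)"
    "\<forall>s\<in>set ss'. \<bar>snd s\<bar> \<le> int (2 * value_bound d n M + d * M)"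
    unfolding value_bound_def by blast
  from lev_run_realize[OF ss'(1) assms(2) refl ss'(3)] obtain ts' where ts': "full.walk p ts' q"
    "length ts' \<le> length ss' * (walk_bound d n M (2 * value_bound d n M + d * M) + 1)"
    "\<forall>k<d. exec ts' u k = v k" by blast
  have "length ts' \<le> run_bound d n M"
    using order_trans[OF ts'(2) mult_le_mono1[OF ss'(2)]] unfolding run_bound_def by linarith
  then show ?thesis using ts' by blast
next
  case False
  then have pure: "pure_walk p ts q" using walk_imp_pure_walk[OF assms(1)] by auto
  have eff: "eff lab2 ts k = int d * (v k - u k)" if "k < d" for k
    using assms(3) that exec_pure[OF pure, of u k] by (simp add: eff_lab2)
  \<comment> \<open>A run without multiplication has a fully prescribed effect; the summand 0 is the
    parameter \<open>X\<close> of \<open>walk_bound\<close>.\<close>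
  have "\<bar>eff lab2 ts k\<bar> \<le> int (2 * d * M + 0)" if "k < d" for k
  proof -
    have "\<bar>v k - u k\<bar> \<le> 2 * int M" using v_le[OF that] assms(4)[OF that] by linarith
    then have "int d * \<bar>v k - u k\<bar> \<le> int d * (2 * int M)" by (intro mult_left_mono) auto
    then show ?thesis unfolding eff[OF that] abs_mult by (simp add: ac_simps)
  qed
  from pure2.short_walk[OF pure assms(2) this] obtain ts' where ts': "pure_walk p ts' q"
    "length ts' \<le> walk_bound d n M 0" "\<forall>k<d. eff lab2 ts' k = eff lab2 ts k"
    unfolding walk_bound_def by blast
  have "exec ts' u k = v k" if "k < d" for k
    using ts'(3) that eff[OF that] dim_pos by (simp add: exec_pure[OF ts'(1)] eff_lab2)
  then show ?thesis using ts' pure_walk_imp_walk unfolding run_bound_def by force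
qed

end

section \<open>Codes of runs\<close>

lemma computable_block_bound [computable_intros]:
  assumes "computable k A" "computable k B"
  shows "computable k (\<lambda>e. block_bound (A e) (B e))"
proof -
  have eq: "block_bound m D = rec_nat 1 (\<lambda>_ y. (2 * (y * m) + 1) * y) D" for m D by (induction D) auto
  show ?thesis unfolding eq by (intro computable_intros assms computable_shift2[OF assms(1)]) auto
qed

lemma computable_item_bound [computable_intros]:
  assumes "computable k A" "computable k B" "computable k C"
  shows "computable k (\<lambda>e. item_bound (A e) (B e) (C e))"
  unfolding item_bound_def by (intro computable_intros assms)

lemma computable_period [computable_intros]:
  assumes "computable k A" "computable k B" "computable k C" "computable k D"
  shows "computable k (\<lambda>e. period (A e) (B e) (C e) (D e))"
  unfolding period_def by (intro computable_intros assms)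

lemma computable_threshold [computable_intros]:
  assumes "computable k A" "computable k B" "computable k C" "computable k D"
  shows "computable k (\<lambda>e. threshold (A e) (B e) (C e) (D e))"
  unfolding threshold_def by (intro computable_intros assms)

lemma computable_ladder [computable_intros]:
  assumes "computable k A" "computable k B" "computable k C" "computable k D" "computable k E" "computable k F"
  shows "computable k (\<lambda>e. ladder (A e) (B e) (C e) (D e) (E e) (F e))"
  unfolding ladder_def
  by (intro computable_intros assms computable_shift[OF assms(1)] computable_shift[OF assms(2)]
      computable_shift[OF assms(4)]) auto

lemma computable_walk_bound [computable_intros]:
  assumes "computable k A" "computable k B" "computable k C" "computable k D"
  shows "computable k (\<lambda>e. walk_bound (A e) (B e) (C e) (D e))"
  unfolding walk_bound_def by (intro computable_intros assms)

lemma computable_run_bound [computable_intros]: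
  assumes "computable k A" "computable k B" "computable k C"
  shows "computable k (\<lambda>e. run_bound (A e) (B e) (C e))"
  unfolding run_bound_def value_bound_def by (intro computable_intros assms)

section \<open>Computable decoding of lists, integers and sequences of transitions\<close>

definition hd_code :: "nat \<Rightarrow> nat" where
  "hd_code m = fst (prod_decode (m - 1))"

definition tl_code :: "nat \<Rightarrow> nat" where
  "tl_code m = snd (prod_decode (m - 1))"

definition nth_code :: "nat \<Rightarrow> nat \<Rightarrow> nat" where
  "nth_code m i = hd_code ((tl_code ^^ i) m)"

lemma prod_decode_0: "prod_decode 0 = (0, 0)"
  using prod_encode_inverse[of "(0, 0)"] by (simp add: prod_encode_def)

text \<open>The code 0 of the empty list is a fixed point of \<open>tl_code\<close>, so reading
  beyond the end yields the default 0.\<close>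

lemma nth_code_list_encode: "nth_code (list_encode xs) i = (if i < length xs then xs ! i else 0)"
proof (induction xs arbitrary: i)
  case Nil
  have "(tl_code ^^ i) 0 = 0" by (induction i) (simp_all add: tl_code_def prod_decode_0)
  then show ?case by (simp add: nth_code_def hd_code_def prod_decode_0)
next
  case (Cons x xs)
  have "tl_code (list_encode (x # xs)) = list_encode xs" by (simp add: tl_code_def)
  then show ?case using Cons[of "i - 1"]
    by (cases i) (simp_all add: nth_code_def funpow_Suc_right hd_code_def del: funpow.simps list_encode.simps(2), simp)
qed

lemma hd_code_le: "hd_code m \<le> m" and tl_code_le: "tl_code m \<le> m"
proof -
  have "fst (prod_decode (m - 1)) \<le> m - 1" "snd (prod_decode (m - 1)) \<le> m - 1"
    using le_prod_encode_1[of "fst (prod_decode (m - 1))" "snd (prod_decode (m - 1))"]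
      le_prod_encode_2[of "snd (prod_decode (m - 1))" "fst (prod_decode (m - 1))"] by simp_all
  then show "hd_code m \<le> m" "tl_code m \<le> m" unfolding hd_code_def tl_code_def by linarith+
qed

lemma nth_code_le: "nth_code m i \<le> m"
proof -
  have "(tl_code ^^ i) m \<le> m" by (induction i) (auto intro: order_trans[OF tl_code_le])
  then show ?thesis unfolding nth_code_def using hd_code_le order_trans by blast
qed

lemma computable_nth_code [computable_intros]:
  assumes "computable k A" "computable k B"
  shows "computable k (\<lambda>e. nth_code (A e) (B e))"
  unfolding nth_code_def hd_code_def tl_code_def by (intro computable_intros assms) auto

text \<open>\<open>int_encode\<close> maps \<open>i \<ge> 0\<close> to \<open>2 * i\<close> and
  \<open>i < 0\<close> to \<open>- 2 * i - 1\<close>, so parity reveals the sign.\<close>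

definition pos_code :: "nat \<Rightarrow> nat" where
  "pos_code m = (if even m then m div 2 else 0)"

definition neg_code :: "nat \<Rightarrow> nat" where
  "neg_code m = (if even m then 0 else Suc (m div 2))"

lemma pos_neg_code: "int (pos_code (int_encode i)) - int (neg_code (int_encode i)) = i"
  by (auto simp: pos_code_def neg_code_def int_encode_def sum_encode_def)

lemma abs_le_int_encode: "\<bar>i\<bar> \<le> int (int_encode i)"
  by (auto simp: int_encode_def sum_encode_def)

lemma computable_pos_code [computable_intros]:
  "computable k A \<Longrightarrow> computable k (\<lambda>e. pos_code (A e))"
  unfolding pos_code_def by (intro computable_intros)

lemma computable_neg_code [computable_intros]:
  "computable k A \<Longrightarrow> computable k (\<lambda>e. neg_code (A e))"
  unfolding neg_code_def by (intro computable_intros)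

text \<open>A sequence of transitions is stored as one number whose digits to base \<open>b\<close>,
  least significant first, are their codes. Quantifying over sequences of length \<open>l\<close> is
  then a search below \<open>b ^ l\<close>.\<close>

definition digit :: "nat \<Rightarrow> nat \<Rightarrow> nat \<Rightarrow> nat" where
  "digit b r i = r div b ^ i mod b"

lemma digits_exist:
  assumes "\<forall>x\<in>set xs. x < b"
  shows "\<exists>r<b ^ length xs. \<forall>i<length xs. digit b r i = xs ! i"
  using assms
proof (induction xs)
  case (Cons x xs)
  then obtain r where r: "r < b ^ length xs" "\<forall>i<length xs. digit b r i = xs ! i" by auto
  have x: "x < b" using Cons.prems by simp
  have "x + b * r < b * (r + 1)" using x by simp
  also have "\<dots> \<le> b * b ^ length xs" using r(1) by (intro mult_le_mono2) simp
  finally have "x + b * r < b ^ length (x # xs)" by simp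
  moreover have "digit b (x + b * r) i = (x # xs) ! i" if "i < length (x # xs)" for i
    using that r(2) x by (cases i) (auto simp: digit_def div_mult2_eq)
  ultimately show ?case by blast
qed simp

lemma computable_digit [computable_intros]:
  assumes "computable k A" "computable k B" "computable k C"
  shows "computable k (\<lambda>e. digit (A e) (B e) (C e))"
  unfolding digit_def by (intro computable_intros assms)

text \<open>An entry \<open>A $$ (0, 1)\<close> outside the matrix is decoded as 0, so dimension 1 needs no special treatment.\<close>

definition coef_code :: "nat \<Rightarrow> nat" where
  "coef_code t = nth_code (nth_code (nth_code t 1) 0) 1 div 2"

lemma computable_coef_code [computable_intros]:
  "computable k A \<Longrightarrow> computable k (\<lambda>e. coef_code (A e))"
  unfolding coef_code_def by (intro computable_intros)

definition part_total :: "(nat \<Rightarrow> nat) \<Rightarrow> nat \<Rightarrow> nat \<Rightarrow> nat" where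
  "part_total c d w = (\<Sum>j<d. c (nth_code w j))"

text \<open>The parameter \<open>c\<close> is \<^const>\<open>pos_code\<close> or \<^const>\<open>neg_code\<close>: all multipliers are nonnegative, so the
  positive and negative parts of the integers can be traced separately.\<close>

definition trace_total :: "(nat \<Rightarrow> nat) \<Rightarrow> nat \<Rightarrow> nat \<Rightarrow> nat \<Rightarrow> nat \<Rightarrow> nat \<Rightarrow> nat" where
  "trace_total c d b r w l = rec_nat (part_total c d w)
    (\<lambda>i y. (if coef_code (digit b r i) = 0 then y else d * coef_code (digit b r i) * y) +
      part_total c d (nth_code (digit b r i) 2)) l"

definition trace_coord :: "(nat \<Rightarrow> nat) \<Rightarrow> nat \<Rightarrow> nat \<Rightarrow> nat \<Rightarrow> nat \<Rightarrow> nat \<Rightarrow> nat \<Rightarrow> nat" where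
  "trace_coord c d b r w k l = rec_nat (c (nth_code w k))
    (\<lambda>i y. (if coef_code (digit b r i) = 0 then y else coef_code (digit b r i) * trace_total c d b r w i) +
      c (nth_code (nth_code (digit b r i) 2) k)) l"

context
  fixes c :: "nat \<Rightarrow> nat"
  assumes c: "\<And>k F. computable k F \<Longrightarrow> computable k (\<lambda>e. c (F e))"
begin

lemma computable_part_total:
  assumes "computable k A" "computable k B"
  shows "computable k (\<lambda>e. part_total c (A e) (B e))"
  unfolding part_total_def by (intro computable_intros c assms computable_shift[OF assms(2)]) auto

lemma computable_trace_total:
  assumes "computable k A" "computable k B" "computable k C" "computable k D" "computable k L"
  shows "computable k (\<lambda>e. trace_total c (A e) (B e) (C e) (D e) (L e))"
  unfolding trace_total_def
  by (intro computable_intros computable_part_total assms assms[THEN computable_shift2]) auto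

lemma computable_trace_coord:
  assumes "computable k A" "computable k B" "computable k C" "computable k D" "computable k K" "computable k L"
  shows "computable k (\<lambda>e. trace_coord c (A e) (B e) (C e) (D e) (K e) (L e))"
  unfolding trace_coord_def
  by (intro computable_intros c computable_trace_total assms assms[THEN computable_shift2]) auto

end

lemmas computable_trace_pos [computable_intros] = computable_trace_coord[OF computable_pos_code]
lemmas computable_trace_neg [computable_intros] = computable_trace_coord[OF computable_neg_code]

definition state_at :: "nat \<Rightarrow> nat \<Rightarrow> nat \<Rightarrow> nat \<Rightarrow> nat" where
  "state_at p b r i = (if i = 0 then p else nth_code (digit b r (i - 1)) 3)"

lemma computable_state_at [computable_intros]:
  assumes "computable k A" "computable k B" "computable k C" "computable k D"
  shows "computable k (\<lambda>e. state_at (A e) (B e) (C e) (D e))"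
  unfolding state_at_def by (intro computable_intros assms)

text \<open>Coordinates are compared with the negative parts moved to the other side, which keeps
  the test within the natural numbers.\<close>

definition run_code :: "nat \<Rightarrow> nat \<Rightarrow> nat \<Rightarrow> nat \<Rightarrow> nat \<Rightarrow> nat \<Rightarrow> nat \<Rightarrow> nat \<Rightarrow> nat \<Rightarrow> bool" where
  "run_code d S p u q v b r l \<longleftrightarrow>
    (\<forall>i<l. digit b r i \<in> set_decode S \<and> nth_code (digit b r i) 0 = state_at p b r i) \<and>
    state_at p b r l = q \<and>
    (\<forall>k<d. trace_coord pos_code d b r u k l + neg_code (nth_code v k) =
      trace_coord neg_code d b r u k l + pos_code (nth_code v k))"

text \<open>The code \<open>N\<close> itself bounds the numbers of states and transitions, the
  coefficients and the vector entries. Transition codes lie below it, hence the base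
  \<open>Suc N\<close>.\<close>

definition accepts :: "nat \<Rightarrow> bool" where
  "accepts N \<longleftrightarrow> (\<exists>l<Suc (run_bound (nth_code (nth_code N 0) 0) N N). \<exists>r<Suc N ^ l.
    run_code (nth_code (nth_code N 0) 0) (nth_code (nth_code N 0) 2)
      (fst (prod_decode (nth_code N 1))) (snd (prod_decode (nth_code N 1)))
      (fst (prod_decode (nth_code N 2))) (snd (prod_decode (nth_code N 2))) (Suc N) r l)"

lemma decidable_accepts: "decidable_in (Suc 0) (\<lambda>e. accepts (e 0))"
  unfolding accepts_def run_code_def by (intro computable_intros) auto

section \<open>Instances of the reachability problem\<close>

lemma J_pow_Suc: "J d ^\<^sub>m Suc m = mat d d (\<lambda>_. int d ^ m)"
proof (induction m)
  case 0
  show ?case by (simp add: J_def)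
next
  case (Suc m)
  have "J d ^\<^sub>m Suc (Suc m) = J d ^\<^sub>m Suc m * J d" by simp
  also have "\<dots> = mat d d (\<lambda>_. int d ^ Suc m)"
    unfolding Suc by (rule eq_matI) (auto simp: J_def scalar_prod_def)
  finally show ?case .
qed

lemma C_ones_cases:
  assumes "A \<in> C_ones" "A \<in> carrier_mat d d"
  obtains "A = 1\<^sub>m d" | m where "A = mat d d (\<lambda>_. int d ^ m)"
proof -
  obtain e n where A: "A = J e ^\<^sub>m n" using assms(1) unfolding C_ones_def by auto
  have "J e ^\<^sub>m n \<in> carrier_mat e e" by (rule pow_carrier_mat) (simp add: J_def)
  \<comment> \<open>Membership in the class does not name the dimension; it is recovered from the
    number of rows.\<close>
  then have "e = d" using assms(2) carrier_matD(1) unfolding A by metis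
  then show thesis using that J_pow_Suc[of d] A by (cases n) (auto simp: J_def)
qed

text \<open>A coefficient 0 encodes the identity matrix. In dimension 1 all matrices are the identity.\<close>

definition matrix_coef :: "nat \<Rightarrow> int mat \<Rightarrow> nat" where
  "matrix_coef d A = (if 2 \<le> d then nat (A $$ (0, 1)) else 0)"

lemma mult_mat_vec_ones:
  assumes "A \<in> C_ones" "A \<in> carrier_mat d d" "x \<in> carrier_vec d" "k < d"
  shows "(A *\<^sub>v x) $ k =
    (if matrix_coef d A = 0 then x $ k else int (matrix_coef d A) * (\<Sum>j<d. x $ j))"
  using assms(1,2)
proof (cases rule: C_ones_cases)
  case 1
  then show ?thesis using assms(3,4) by (simp add: matrix_coef_def)
next
  case (2 m)
  then have "(A *\<^sub>v x) $ k = (\<Sum>j<d. int d ^ m * x $ j)"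
    using assms(3,4) by (simp add: scalar_prod_def atLeast0LessThan)
  also have "\<dots> = int d ^ m * (\<Sum>j<d. x $ j)" by (simp add: sum_distrib_left)
  finally have mult: "(A *\<^sub>v x) $ k = int d ^ m * (\<Sum>j<d. x $ j)" .
  show ?thesis
  proof (cases "2 \<le> d")
    case True
    then have "matrix_coef d A = d ^ m" using 2 by (simp add: matrix_coef_def nat_power_eq)
    then show ?thesis using mult True by simp
  next
    case False
    then have "d = 1" using assms(4) by simp
    then show ?thesis using mult assms(4) by (simp add: matrix_coef_def)
  qed
qed

lemma matrix_entry_nonneg:
  assumes "A \<in> C_ones" "A \<in> carrier_mat d d" "i < d" "j < d" shows "0 \<le> A $$ (i, j)"
  using assms(1,2) by (cases rule: C_ones_cases) (use assms(3,4) in auto)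

lemma nth_encode_vec: "k < dim_vec v \<Longrightarrow> nth_code (encode_vec v) k = int_encode (v $ k)"
  by (simp add: encode_vec_def nth_code_list_encode)

lemma coef_code_encode:
  assumes "A \<in> C_ones" "A \<in> carrier_mat d d" "1 \<le> d"
  shows "coef_code (encode_transition (p, A, b, q)) = matrix_coef d A"
proof -
  have "nth_code (encode_transition (p, A, b, q)) 1 = encode_mat A"
    by (simp add: encode_transition_def nth_code_list_encode del: list_encode.simps)
  moreover have "nth_code (encode_mat A) 0 = list_encode (map int_encode (mat_to_list A ! 0))"
    using assms by (simp add: encode_mat_def nth_code_list_encode mat_to_list_def)
  moreover have "mat_to_list A ! 0 = map (\<lambda>j. A $$ (0, j)) [0..<d]"
    using assms by (simp add: mat_to_list_def)
  moreover have "nth_code (list_encode (map int_encode (map (\<lambda>j. A $$ (0, j)) [0..<d]))) 1 =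
      (if 2 \<le> d then int_encode (A $$ (0, 1)) else 0)"
    by (auto simp: nth_code_list_encode)
  moreover have "int_encode (A $$ (0, 1)) div 2 = nat (A $$ (0, 1))" if "2 \<le> d"
    using matrix_entry_nonneg[OF assms(1,2), of 0 1] that by (simp add: int_encode_def sum_encode_def)
  ultimately show ?thesis by (simp add: coef_code_def matrix_coef_def)
qed

lemma encode_mat_inj:
  assumes "A \<in> carrier_mat d d" "B \<in> carrier_mat d d" "encode_mat A = encode_mat B"
  shows "A = B"
proof -
  have inj: "inj (\<lambda>r. list_encode (map int_encode r))"
    by (intro injI) (simp add: list_encode_eq inj_map_eq_map[OF inj_int_encode])
  have "mat_to_list A = mat_to_list B"
    using assms(3) unfolding encode_mat_def list_encode_eq inj_map_eq_map[OF inj] .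
  then have "\<forall>i<d. \<forall>j<d. A $$ (i, j) = B $$ (i, j)"
    using assms(1,2) by (auto simp: mat_to_list_def map_eq_conv)
  then show ?thesis using assms(1,2) by (intro eq_matI) auto
qed

lemma encode_vec_inj: "encode_vec v = encode_vec w \<Longrightarrow> v = w"
  unfolding encode_vec_def list_encode_eq inj_map_eq_map[OF inj_int_encode] by (metis vec_list)

lemma set_decode_less: "x \<in> set_decode m \<Longrightarrow> x < m"
proof -
  assume "x \<in> set_decode m"
  then have "2 ^ x \<le> m" by (auto simp: set_decode_def intro: ccontr)
  then show "x < m" using less_exp[of x] by linarith
qed

text \<open>The positionwise form of a walk, to be matched with the conditions of
  \<open>run_code\<close> on single digits.\<close>

lemma (in walks) walk_nth:
  "walk p ts q \<longleftrightarrow> (\<forall>i<length ts. ts ! i \<in> T \<and> src (ts ! i) = (if i = 0 then p else tgt (ts ! (i - 1)))) \<and>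
    (if ts = [] then p else tgt (last ts)) = q"
proof (induction ts arbitrary: q rule: rev_induct)
  case (snoc t ts)
  define R where "R xs i \<longleftrightarrow> xs ! i \<in> T \<and> src (xs ! i) = (if i = 0 then p else tgt (xs ! (i - 1)))" for xs i
  have "(\<forall>i<length (ts @ [t]). R (ts @ [t]) i) \<longleftrightarrow> (\<forall>i<length ts. R (ts @ [t]) i) \<and> R (ts @ [t]) (length ts)"
    by (simp add: All_less_Suc conj_commute)
  also have "(\<forall>i<length ts. R (ts @ [t]) i) \<longleftrightarrow> (\<forall>i<length ts. R ts i)"
    by (simp add: R_def nth_append less_imp_diff_less)
  also have "R (ts @ [t]) (length ts) \<longleftrightarrow> t \<in> T \<and> src t = (if ts = [] then p else tgt (last ts))"
    by (simp add: R_def nth_append last_conv_nth)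
  finally have "(\<forall>i<length (ts @ [t]). R (ts @ [t]) i) \<longleftrightarrow>
    (\<forall>i<length ts. R ts i) \<and> t \<in> T \<and> src t = (if ts = [] then p else tgt (last ts))" .
  moreover have "walk p ts (src t) \<longleftrightarrow> (\<forall>i<length ts. R ts i) \<and> (if ts = [] then p else tgt (last ts)) = src t"
    unfolding R_def by (rule snoc.IH)
  moreover have "walk p (ts @ [t]) q \<longleftrightarrow> walk p ts (src t) \<and> t \<in> T \<and> tgt t = q"
    by (auto simp: walk_append)
  ultimately have "walk p (ts @ [t]) q \<longleftrightarrow> (\<forall>i<length (ts @ [t]). R (ts @ [t]) i) \<and> tgt t = q"
    by metis
  then show ?case by (simp only: R_def last_snoc snoc_eq_iff_butlast append_is_Nil_conv list.distinct if_False simp_thms)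
qed auto

lemma (in ones_system) app_cong: "\<forall>k<d. x k = y k \<Longrightarrow> \<forall>k<d. app t x k = app t y k"
  by (simp add: app_def total_def)

lemma (in ones_system) exec_cong: "\<forall>k<d. x k = y k \<Longrightarrow> \<forall>k<d. exec ts x k = exec ts y k"
proof (induction ts arbitrary: x y)
  case (Cons t ts)
  show ?case using Cons.IH[OF app_cong[OF Cons.prems]] by simp
qed simp

section \<open>Correctness of the search for a single instance\<close>

locale ones_instance =
  fixes V :: "nat vass" and p :: nat and u :: "int vec" and q :: nat and v :: "int vec"
  assumes inst: "(V, (p, u), (q, v)) \<in> reach_instances C_ones"
begin

abbreviation "N \<equiv> encode_instance (V, (p, u), (q, v))"
abbreviation "tsrc \<equiv> \<lambda>t::nat transition. fst t"
abbreviation "tgt \<equiv> \<lambda>t::nat transition. snd (snd (snd t))"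
abbreviation "mat_of \<equiv> \<lambda>t::nat transition. fst (snd t)"
abbreviation "vec_of \<equiv> \<lambda>t::nat transition. fst (snd (snd t))"
abbreviation "coef \<equiv> \<lambda>t. matrix_coef (vdim V) (mat_of t)"
abbreviation "off \<equiv> \<lambda>t k. vec_of t $ k"

lemma instance_facts:
  "1 \<le> vdim V" "finite (states V)" "finite (transitions V)" "p \<in> states V" "q \<in> states V"
  "u \<in> carrier_vec (vdim V)" "v \<in> carrier_vec (vdim V)"
  using inst by (auto simp: reach_instances_def affine_zvass_def configs_def)

lemma transition_facts:
  assumes "t \<in> transitions V"
  shows "tsrc t \<in> states V" "tgt t \<in> states V" "mat_of t \<in> C_ones"
    "mat_of t \<in> carrier_mat (vdim V) (vdim V)" "vec_of t \<in> carrier_vec (vdim V)"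
  using inst assms by (cases t; fastforce simp: reach_instances_def affine_zvass_def)+

lemma nth_N:
  "nth_code (nth_code N 0) 0 = vdim V"
  "nth_code (nth_code N 0) 1 = set_encode (states V)"
  "nth_code (nth_code N 0) 2 = set_encode (encode_transition ` transitions V)"
  "prod_decode (nth_code N 1) = (p, encode_vec u)"
  "prod_decode (nth_code N 2) = (q, encode_vec v)"
  by (simp_all add: encode_instance_def encode_vass_def encode_config_def nth_code_list_encode
      del: list_encode.simps)

lemma nth_transition:
  "nth_code (encode_transition t) 0 = tsrc t"
  "nth_code (encode_transition t) 2 = encode_vec (vec_of t)"
  "nth_code (encode_transition t) 3 = tgt t"
  by (cases t, simp add: encode_transition_def nth_code_list_encode del: list_encode.simps)+

lemma coef_code_transition: "t \<in> transitions V \<Longrightarrow> coef_code (encode_transition t) = coef t"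
  using coef_code_encode[OF transition_facts(3,4)] instance_facts(1) by (cases t) auto

lemma inj_encode_transition: "inj_on encode_transition (transitions V)"
proof (rule inj_onI)
  fix s t assume s: "s \<in> transitions V" and t: "t \<in> transitions V"
    and eq: "encode_transition s = encode_transition t"
  then have "fst s = fst t" "encode_mat (mat_of s) = encode_mat (mat_of t)"
    "encode_vec (vec_of s) = encode_vec (vec_of t)" "tgt s = tgt t"
    by (auto simp: encode_transition_def list_encode_eq split: prod.splits simp del: list_encode.simps)
  moreover have "mat_of s = mat_of t"
    using calculation(2) encode_mat_inj transition_facts(4)[OF s] transition_facts(4)[OF t] by blast
  ultimately show "s = t" using encode_vec_inj by (auto intro!: prod_eqI)
qed

lemma set_decode_transitions: "set_decode (nth_code (nth_code N 0) 2) = encode_transition ` transitions V"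
  using instance_facts(3) by (simp add: nth_N)

lemma transition_code_less: "t \<in> transitions V \<Longrightarrow> encode_transition t < N"
  using set_decode_less[of "encode_transition t" "nth_code (nth_code N 0) 2"] set_decode_transitions
    nth_code_le[of "nth_code N 0" 2] nth_code_le[of N 0] by force

lemma entry_bounds:
  shows "t \<in> transitions V \<Longrightarrow> coef t \<le> N"
    and "t \<in> transitions V \<Longrightarrow> k < vdim V \<Longrightarrow> \<bar>off t k\<bar> \<le> int N"
    and "k < vdim V \<Longrightarrow> \<bar>u $ k\<bar> \<le> int N"
    and "k < vdim V \<Longrightarrow> \<bar>v $ k\<bar> \<le> int N"
proof -
  have vec: "\<bar>w $ k\<bar> \<le> int (encode_vec w)" if "w \<in> carrier_vec (vdim V)" "k < vdim V" for w k
    using nth_code_le[of "encode_vec w" k] abs_le_int_encode[of "w $ k"] that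
    by (simp add: nth_encode_vec)
  have pd: "snd (prod_decode m) \<le> m" for m
    using le_prod_encode_2[of "snd (prod_decode m)" "fst (prod_decode m)"] by simp
  show "coef t \<le> N" if t: "t \<in> transitions V"
  proof -
    have "coef_code (encode_transition t) \<le> nth_code (nth_code (nth_code (encode_transition t) 1) 0) 1"
      unfolding coef_code_def by simp
    also have "\<dots> \<le> encode_transition t" using nth_code_le order_trans by meson
    finally show ?thesis using transition_code_less[OF t] coef_code_transition[OF t] by simp
  qed
  show "\<bar>off t k\<bar> \<le> int N" if t: "t \<in> transitions V" "k < vdim V"
    using vec[OF transition_facts(5)[OF t(1)] t(2)] nth_code_le[of "encode_transition t" 2]
      transition_code_less[OF t(1)] unfolding nth_transition by linarith
  show "\<bar>u $ k\<bar> \<le> int N" if "k < vdim V"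
    using vec[OF instance_facts(6) that] pd[of "nth_code N 1"] nth_code_le[of N 1] unfolding nth_N by simp
  show "\<bar>v $ k\<bar> \<le> int N" if "k < vdim V"
    using vec[OF instance_facts(7) that] pd[of "nth_code N 2"] nth_code_le[of N 2] unfolding nth_N by simp
qed

sublocale sys: ones_target "transitions V" tsrc tgt coef off "vdim V" "states V" N N q "\<lambda>k. v $ k"
proof
  \<comment> \<open>Elements of a decoded set are smaller than its code, so the code bounds the
    number of elements.\<close>
  have "states V = set_decode (nth_code (nth_code N 0) 1)" using instance_facts(2) unfolding nth_N by simp
  also have "\<dots> \<subseteq> {..<N}"
    using set_decode_less nth_code_le[of "nth_code N 0" 1] nth_code_le[of N 0] by fastforce
  finally show "card (states V) \<le> N" using card_mono[of "{..<N}" "states V"] by simp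
  have "encode_transition ` transitions V \<subseteq> {..<N}" using transition_code_less by auto
  then show "card (transitions V) \<le> N"
    using card_image[OF inj_encode_transition] card_mono[of "{..<N}" "encode_transition ` transitions V"] by simp
  show "2 \<le> vdim V" if "0 < coef t" for t using that by (simp add: matrix_coef_def split: if_splits)
qed (use instance_facts transition_facts entry_bounds in auto)

lemma app_step:
  assumes "t \<in> transitions V" "x \<in> carrier_vec (vdim V)" "k < vdim V"
  shows "(mat_of t *\<^sub>v x + vec_of t) $ k = sys.app t (\<lambda>k. x $ k) k"
  using mult_mat_vec_ones[OF transition_facts(3,4)[OF assms(1)] assms(2,3)]
    transition_facts(5)[OF assms(1)] assms(3)
  by (simp add: sys.app_def sys.total_def)

lemma reachable_walk:
  assumes "reachable V (p, u) c"
  shows "\<exists>ts. sys.full.walk p ts (fst c) \<and> snd c \<in> carrier_vec (vdim V) \<and>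
    (\<forall>k<vdim V. sys.exec ts (\<lambda>k. u $ k) k = snd c $ k)"
  using assms unfolding reachable_def
proof (induction rule: rtranclp_induct)
  case base
  show ?case using instance_facts by (intro exI[of _ "[]"]) simp
next
  case (step c c')
  obtain ts where ts: "sys.full.walk p ts (fst c)" "snd c \<in> carrier_vec (vdim V)"
    "\<forall>k<vdim V. sys.exec ts (\<lambda>k. u $ k) k = snd c $ k" using step.IH by blast
  obtain t where t: "t \<in> transitions V" "tsrc t = fst c" "tgt t = fst c'"
    "snd c' = mat_of t *\<^sub>v snd c + vec_of t"
    using step.hyps(2) unfolding step_def fires_def by fastforce
  have "sys.full.walk p (ts @ [t]) (fst c')" using ts(1) t by (auto simp: sys.full.walk_append)
  moreover have "snd c' \<in> carrier_vec (vdim V)"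
    using step.hyps(2) unfolding step_def configs_def by auto
  moreover have "sys.exec (ts @ [t]) (\<lambda>k. u $ k) k = snd c' $ k" if "k < vdim V" for k
    using sys.app_cong[OF ts(3), of t] app_step[OF t(1) ts(2) that] that
    by (simp add: sys.exec_append t(4))
  ultimately show ?case by blast
qed

lemma walk_reachable:
  assumes "sys.full.walk r ts q'" "r \<in> states V" "x \<in> carrier_vec (vdim V)"
  shows "reachable V (r, x) (q', vec (vdim V) (sys.exec ts (\<lambda>k. x $ k)))"
  using assms
proof (induction ts arbitrary: r x)
  case Nil
  have "vec (vdim V) (\<lambda>k. x $ k) = x" using Nil(3) by (intro eq_vecI) auto
  then show ?case using Nil(1) by (simp add: reachable_def)
next
  case (Cons t ts)
  let ?y = "mat_of t *\<^sub>v x + vec_of t"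
  have t: "t \<in> transitions V" "tsrc t = r" "sys.full.walk (tgt t) ts q'" using Cons.prems(1) by auto
  have y: "?y \<in> carrier_vec (vdim V)" using transition_facts(4,5)[OF t(1)] Cons.prems(3)
    by (intro add_carrier_vec mult_mat_vec_carrier)
  have "fires t (r, x) (tgt t, ?y)" using t(2) by (cases t) (auto simp: fires_def)
  then have first: "step V (r, x) (tgt t, ?y)"
    using t(1) y Cons.prems(2,3) transition_facts(2)[OF t(1)] by (auto simp: step_def configs_def)
  have "\<forall>k<vdim V. ?y $ k = sys.app t (\<lambda>k. x $ k) k" using app_step[OF t(1) Cons.prems(3)] by blast
  then have "\<forall>k<vdim V. sys.exec ts (\<lambda>k. ?y $ k) k = sys.exec (t # ts) (\<lambda>k. x $ k) k"
    using sys.exec_cong by simp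
  then have last: "vec (vdim V) (sys.exec (t # ts) (\<lambda>k. x $ k)) = vec (vdim V) (sys.exec ts (\<lambda>k. ?y $ k))"
    by (intro eq_vecI) auto
  show ?case
    using converse_rtranclp_into_rtranclp[of "step V", OF first]
      Cons.IH[OF t(3) transition_facts(2)[OF t(1)] y] unfolding reachable_def last by blast
qed

lemma reachable_iff:
  "reachable V (p, u) (q, v) \<longleftrightarrow>
    (\<exists>ts. sys.full.walk p ts q \<and> (\<forall>k<vdim V. sys.exec ts (\<lambda>k. u $ k) k = v $ k))"
proof
  assume "reachable V (p, u) (q, v)"
  from reachable_walk[OF this] show
    "\<exists>ts. sys.full.walk p ts q \<and> (\<forall>k<vdim V. sys.exec ts (\<lambda>k. u $ k) k = v $ k)" by auto
next
  assume "\<exists>ts. sys.full.walk p ts q \<and> (\<forall>k<vdim V. sys.exec ts (\<lambda>k. u $ k) k = v $ k)"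
  then obtain ts where ts: "sys.full.walk p ts q" "\<forall>k<vdim V. sys.exec ts (\<lambda>k. u $ k) k = v $ k" by blast
  have "vec (vdim V) (sys.exec ts (\<lambda>k. u $ k)) = v" using ts(2) instance_facts(7) by (intro eq_vecI) auto
  then show "reachable V (p, u) (q, v)"
    using walk_reachable[OF ts(1) instance_facts(4,6)] by simp
qed

lemma part_total_diff:
  assumes "w \<in> carrier_vec (vdim V)"
  shows "int (part_total pos_code (vdim V) (encode_vec w)) - int (part_total neg_code (vdim V) (encode_vec w)) =
    sys.total (\<lambda>k. w $ k)"
proof -
  have "(\<Sum>j<vdim V. int (pos_code (nth_code (encode_vec w) j))) -
      (\<Sum>j<vdim V. int (neg_code (nth_code (encode_vec w) j))) = (\<Sum>j<vdim V. w $ j)"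
    unfolding sum_subtractf[symmetric] using assms
    by (intro sum.cong refl) (simp add: nth_encode_vec pos_neg_code)
  then show ?thesis by (simp add: part_total_def sys.total_def)
qed

context
  fixes ts :: "nat transition list" and b r :: nat
  assumes ts: "\<forall>i<length ts. ts ! i \<in> transitions V \<and> digit b r i = encode_transition (ts ! i)"
begin

lemma trace_total_diff:
  assumes "l \<le> length ts"
  shows "int (trace_total pos_code (vdim V) b r (encode_vec u) l) -
      int (trace_total neg_code (vdim V) b r (encode_vec u) l) = sys.total (sys.exec (take l ts) (\<lambda>k. u $ k))"
  using assms
proof (induction l)
  case 0
  then show ?case using part_total_diff[OF instance_facts(6)] by (simp add: trace_total_def)
next
  case (Suc l)
  define t where "t = ts ! l"
  have t: "t \<in> transitions V" "digit b r l = encode_transition t" using ts Suc.prems by (auto simp: t_def)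
  define x where "x = sys.exec (take l ts) (\<lambda>k. u $ k)"
  have exec: "sys.exec (take (Suc l) ts) (\<lambda>k. u $ k) = sys.app t x"
    using Suc.prems by (simp add: take_Suc_conv_app_nth sys.exec_append t_def x_def)
  have step: "trace_total c (vdim V) b r (encode_vec u) (Suc l) =
      (if coef t = 0 then trace_total c (vdim V) b r (encode_vec u) l
       else vdim V * coef t * trace_total c (vdim V) b r (encode_vec u) l) +
      part_total c (vdim V) (encode_vec (vec_of t))" for c
    by (simp add: trace_total_def t(2) coef_code_transition[OF t(1)] nth_transition)
  have IH: "int (trace_total pos_code (vdim V) b r (encode_vec u) l) =
      int (trace_total neg_code (vdim V) b r (encode_vec u) l) + sys.total x"
    using Suc by (simp add: x_def)
  have off: "int (part_total pos_code (vdim V) (encode_vec (vec_of t))) =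
      int (part_total neg_code (vdim V) (encode_vec (vec_of t))) + sys.total (off t)"
    using part_total_diff[OF transition_facts(5)[OF t(1)]] by simp
  show ?case
  proof (cases "coef t = 0")
    case True
    then have "sys.total (sys.app t x) = sys.total x + sys.total (off t)"
      by (simp add: sys.app_def sys.total_def sum.distrib)
    then show ?thesis unfolding exec step using True IH off by simp
  next
    case False
    then show ?thesis unfolding exec step using sys.total_app[of t x] IH off by (simp add: algebra_simps)
  qed
qed

lemma trace_coord_diff:
  assumes "l \<le> length ts" "k < vdim V"
  shows "int (trace_coord pos_code (vdim V) b r (encode_vec u) k l) -
      int (trace_coord neg_code (vdim V) b r (encode_vec u) k l) = sys.exec (take l ts) (\<lambda>k. u $ k) k"
  using assms(1)
proof (induction l)
  case 0
  have "k < dim_vec u" using instance_facts(6) assms(2) by simp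
  then show ?case by (simp add: trace_coord_def nth_encode_vec pos_neg_code)
next
  case (Suc l)
  define t where "t = ts ! l"
  have t: "t \<in> transitions V" "digit b r l = encode_transition t" using ts Suc.prems by (auto simp: t_def)
  define x where "x = sys.exec (take l ts) (\<lambda>k. u $ k)"
  have exec: "sys.exec (take (Suc l) ts) (\<lambda>k. u $ k) = sys.app t x"
    using Suc.prems by (simp add: take_Suc_conv_app_nth sys.exec_append t_def x_def)
  have k: "k < dim_vec (vec_of t)" using transition_facts(5)[OF t(1)] assms(2) by simp
  have step: "trace_coord c (vdim V) b r (encode_vec u) k (Suc l) =
      (if coef t = 0 then trace_coord c (vdim V) b r (encode_vec u) k l
       else coef t * trace_total c (vdim V) b r (encode_vec u) l) + c (int_encode (off t k))" for c
    by (simp add: trace_coord_def t(2) coef_code_transition[OF t(1)] nth_transition nth_encode_vec[OF k])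
  have IH: "int (trace_coord pos_code (vdim V) b r (encode_vec u) k l) =
      int (trace_coord neg_code (vdim V) b r (encode_vec u) k l) + x k"
    using Suc by (simp add: x_def)
  have tot: "int (trace_total pos_code (vdim V) b r (encode_vec u) l) =
      int (trace_total neg_code (vdim V) b r (encode_vec u) l) + sys.total x"
    using trace_total_diff[of l] Suc.prems by (simp add: x_def)
  have off: "int (pos_code (int_encode (off t k))) = int (neg_code (int_encode (off t k))) + off t k"
    using pos_neg_code[of "off t k"] by simp
  show ?case unfolding exec step using IH tot off by (simp add: sys.app_def algebra_simps)
qed

lemma state_at_eq: "l \<le> length ts \<Longrightarrow> state_at p b r l = (if l = 0 then p else tgt (ts ! (l - 1)))"
  using ts by (simp add: state_at_def nth_transition)

lemma run_code_iff:
  "run_code (vdim V) (nth_code (nth_code N 0) 2) p (encode_vec u) q (encode_vec v) b r (length ts) \<longleftrightarrow>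
    sys.full.walk p ts q \<and> (\<forall>k<vdim V. sys.exec ts (\<lambda>k. u $ k) k = v $ k)"
proof -
  have "(trace_coord pos_code (vdim V) b r (encode_vec u) k (length ts) + neg_code (nth_code (encode_vec v) k) =
      trace_coord neg_code (vdim V) b r (encode_vec u) k (length ts) + pos_code (nth_code (encode_vec v) k)) \<longleftrightarrow>
      sys.exec ts (\<lambda>k. u $ k) k = v $ k" if "k < vdim V" for k
  proof -
    have "nth_code (encode_vec v) k = int_encode (v $ k)" using nth_encode_vec instance_facts(7) that by simp
    then show ?thesis using trace_coord_diff[OF le_refl that] pos_neg_code[of "v $ k"] by auto
  qed
  moreover have "sys.full.walk p ts q \<longleftrightarrow>
    (\<forall>i<length ts. digit b r i \<in> set_decode (nth_code (nth_code N 0) 2) \<and>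
      nth_code (digit b r i) 0 = state_at p b r i) \<and> state_at p b r (length ts) = q"
    unfolding sys.full.walk_nth set_decode_transitions using ts state_at_eq
    by (auto simp: nth_transition last_conv_nth)
  ultimately show ?thesis unfolding run_code_def by auto
qed

end

text \<open>An accepted number spells a run. The length bound enters in the converse, where
  \<open>short_run\<close> supplies a run within the range of the search.\<close>

lemma accepts_iff: "accepts N \<longleftrightarrow> reachable V (p, u) (q, v)"
proof
  assume "accepts N"
  then obtain l r where r: "run_code (vdim V) (nth_code (nth_code N 0) 2) p (encode_vec u) q (encode_vec v) (Suc N) r l"
    unfolding accepts_def nth_N(1,4,5) by auto
  define ts where "ts = map (\<lambda>i. inv_into (transitions V) encode_transition (digit (Suc N) r i)) [0..<l]"
  have "\<forall>i<l. digit (Suc N) r i \<in> encode_transition ` transitions V"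
    using r unfolding run_code_def set_decode_transitions by blast
  then have "\<forall>i<length ts. ts ! i \<in> transitions V \<and> digit (Suc N) r i = encode_transition (ts ! i)"
    by (simp add: ts_def inv_into_into f_inv_into_f)
  from run_code_iff[OF this] r show "reachable V (p, u) (q, v)"
    unfolding reachable_iff by (auto simp: ts_def)
next
  assume "reachable V (p, u) (q, v)"
  then obtain ts where ts: "sys.full.walk p ts q" "\<forall>k<vdim V. sys.exec ts (\<lambda>k. u $ k) k = v $ k"
    unfolding reachable_iff by blast
  from sys.short_run[OF ts(1) instance_facts(4) ts(2) entry_bounds(3)] obtain ts' where
    ts': "sys.full.walk p ts' q" "\<forall>k<vdim V. sys.exec ts' (\<lambda>k. u $ k) k = v $ k"
    "length ts' \<le> run_bound (vdim V) N N" by blast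
  have sub: "set ts' \<subseteq> transitions V" using sys.full.walk_subset[OF ts'(1)] .
  have "\<forall>x\<in>set (map encode_transition ts'). x < Suc N"
  proof
    fix x assume "x \<in> set (map encode_transition ts')"
    then have "x \<in> encode_transition ` transitions V" using sub by auto
    then have "x < N" using transition_code_less by blast
    then show "x < Suc N" by (rule less_SucI)
  qed
  from digits_exist[OF this] obtain r where r: "r < Suc N ^ length ts'"
    "\<forall>i<length ts'. digit (Suc N) r i = encode_transition (ts' ! i)" by auto
  then have "\<forall>i<length ts'. ts' ! i \<in> transitions V \<and> digit (Suc N) r i = encode_transition (ts' ! i)"
    using sub by auto
  from run_code_iff[OF this] ts'(1,2) have
    "run_code (vdim V) (nth_code (nth_code N 0) 2) p (encode_vec u) q (encode_vec v) (Suc N) r (length ts')"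
    by blast
  then show "accepts N"
    unfolding accepts_def nth_N(1,4,5) fst_conv snd_conv using r(1) ts'(3) less_Suc_eq_le by blast
qed

end

theorem theorem7p1:
  shows "decidable_problem encode_instance (reach_instances C_ones)
           (\<lambda>(V, c, c'). reachable V c c')"
proof (rule decidable_problemI[OF decidable_accepts])
  fix x :: instance_data assume x: "x \<in> reach_instances C_ones"
  obtain V p u q v where [simp]: "x = (V, (p, u), (q, v))" by (metis surj_pair)
  interpret ones_instance V p u q v using x by unfold_locales simp
  show "(case x of (V, c, c') \<Rightarrow> reachable V c c') \<longleftrightarrow> accepts (encode_instance x)"
    using accepts_iff by simp
qed

end
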